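(* Let $n\geq 1$. The lattice $\mathrm{Cong}(\mathcal{P}_n^\Phi)$ contains five-element diamond and pentagon sublattices, and hence is not modular (or distributive).
   Context: Let $\mathbb{N}=\{0,1,2,\dots\}$ and, for $n\ge 1$, let $[n]=\{1,\dots,n\}$, with disjoint copies $[n]'=\{1',\dots,n'\}$ and $[n]''=\{1'',\dots,n''\}$. The partition monoid $\mathcal{P}_n$ consists of all set partitions of $[n]\cup[n]'$. For $\alpha,\beta\in\mathcal{P}_n$ the product graph $\Gamma(\alpha,\beta)$ has vertex set $[n]\cup[n]''\cup[n]'$; two vertices of $[n]\cup[n]''$ are joined when they lie in a common block of $\alpha$ after renaming each $x'$ of $\alpha$ to $x''$, and two vertices of $[n]''\cup[n]'$ are joined when they lie in a common block of $\beta$ after renaming each $x$ of $\beta$ to $x''$. The product $\alpha\beta\in\mathcal{P}_n$ is the partition in which $x,y\in[n]\cup[n]'$ are in the same block iff they lie in the same connected component of $\Gamma(\alpha,\beta)$. $\Phi(\alpha,\beta)$ is the number of connected components of $\Gamma(\alpha,\beta)$ wholly contained in $[n]''$. The twisted partition monoid is $\mathcal{P}_n^\Phi=\mathbb{N}\times\mathcal{P}_n$ with product $(i,\alpha)(j,\beta)=(i+j+\Phi(\alpha,\beta),\alpha\beta)$. For a monoid $M$, $\mathrm{Cong}(M)$ is the lattice of all congruences on $M$ ordered by inclusion. The five-element diamond is the lattice with a bottom, a top and three pairwise incomparable middle elements (usually $M_3$); the pentagon is the five-element lattice $N_5=\{0,a,b,c,1\}$ with $0<b<c<1$, $0<a<1$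 and $a$ incomparable to $b$ and $c$. A sublattice is a subset closed under the meet and join of the ambient lattice. *)

theory Defs
  imports "HOL-Library.Disjoint_Sets" "HOL-Algebra.Group" "HOL-Algebra.Complete_Lattice"
begin

section \<open>The twisted partition monoid\<close>

text \<open>\<open>Up x\<close>, \<open>Low x\<close> and \<open>Mid x\<close> are the vertices written $x$, $x'$ and $x''$.
  Partitions only use \<open>Up\<close> and \<open>Low\<close> vertices; \<open>Mid\<close> vertices occur in product graphs.\<close>

datatype vertex = Up nat | Mid nat | Low nat

definition boundary :: "nat \<Rightarrow> vertex set" where
  "boundary n = Up ` {1..n} \<union> Low ` {1..n}"

definition partitions :: "nat \<Rightarrow> vertex set set set" where
  "partitions n = {\<alpha>. partition_on (boundary n) \<alpha>}"

fun low_to_mid :: "vertex \<Rightarrow> vertex" where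
  "low_to_mid (Low x) = Mid x"
| "low_to_mid v = v"

fun up_to_mid :: "vertex \<Rightarrow> vertex" where
  "up_to_mid (Up x) = Mid x"
| "up_to_mid v = v"

definition product_vertices :: "nat \<Rightarrow> vertex set" where
  "product_vertices n = Up ` {1..n} \<union> Mid ` {1..n} \<union> Low ` {1..n}"

definition product_edges :: "vertex set set \<Rightarrow> vertex set set \<Rightarrow> vertex rel" where
  "product_edges \<alpha> \<beta> =
     {(u, v). \<exists>A\<in>\<alpha>. u \<in> low_to_mid ` A \<and> v \<in> low_to_mid ` A} \<union>
     {(u, v). \<exists>B\<in>\<beta>. u \<in> up_to_mid ` B \<and> v \<in> up_to_mid ` B}"

definition product_components ::
    "nat \<Rightarrow> vertex set set \<Rightarrow> vertex set set \<Rightarrow> vertex set set" where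
  "product_components n \<alpha> \<beta> = product_vertices n // (product_edges \<alpha> \<beta>)\<^sup>*"

definition partition_mult ::
    "nat \<Rightarrow> vertex set set \<Rightarrow> vertex set set \<Rightarrow> vertex set set" where
  "partition_mult n \<alpha> \<beta> =
     boundary n // {(x, y) \<in> boundary n \<times> boundary n. (x, y) \<in> (product_edges \<alpha> \<beta>)\<^sup>*}"

definition partition_one :: "nat \<Rightarrow> vertex set set" where
  "partition_one n = (\<lambda>x. {Up x, Low x}) ` {1..n}"

definition Phi :: "nat \<Rightarrow> vertex set set \<Rightarrow> vertex set set \<Rightarrow> nat" where
  "Phi n \<alpha> \<beta> = card {C \<in> product_components n \<alpha> \<beta>. C \<subseteq> Mid ` {1..n}}"

definition twisted_partition_monoid :: "nat \<Rightarrow> (nat \<times> vertex set set) monoid" where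
  "twisted_partition_monoid n =
     \<lparr>carrier = UNIV \<times> partitions n,
      mult = (\<lambda>(i, \<alpha>) (j, \<beta>). (i + j + Phi n \<alpha> \<beta>, partition_mult n \<alpha> \<beta>)),
      one = (0, partition_one n)\<rparr>"


section \<open>The lattice of congruences\<close>

definition congruence_on :: "('a, 'b) monoid_scheme \<Rightarrow> 'a rel \<Rightarrow> bool" where
  "congruence_on M r \<longleftrightarrow> equiv (carrier M) r \<and>
     (\<forall>(x, y)\<in>r. \<forall>(u, v)\<in>r. (x \<otimes>\<^bsub>M\<^esub> u, y \<otimes>\<^bsub>M\<^esub> v) \<in> r)"

definition Cong :: "('a, 'b) monoid_scheme \<Rightarrow> 'a rel gorder" where
  "Cong M = \<lparr>carrier = {r. congruence_on M r}, eq = (=), le = (\<subseteq>)\<rparr>"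

lemma complete_lattice_Cong:
  fixes M (structure)
  assumes closed: "\<And>x y. x \<in> carrier M \<Longrightarrow> y \<in> carrier M \<Longrightarrow> x \<otimes> y \<in> carrier M"
  shows "complete_lattice (Cong M)"
proof -
  interpret L: partial_order "Cong M"
    by standard (auto simp: Cong_def)
  show ?thesis
  proof (rule L.complete_lattice_criterion1)
    have "congruence_on M (carrier M \<times> carrier M)"
      using closed
      by (auto simp: congruence_on_def intro!: equivI refl_onI symI transI)
    then have "greatest (Cong M) (carrier M \<times> carrier M) (carrier (Cong M))"
      by (auto simp: greatest_def Cong_def congruence_on_def equiv_def refl_on_def)
    then show "\<exists>g. greatest (Cong M) g (carrier (Cong M))" ..
  next
    fix A assume A: "A \<subseteq> carrier (Cong M)" "A \<noteq> {}"
    then have c: "\<And>r. r \<in> A \<Longrightarrow> congruence_on M r"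
      by (auto simp: Cong_def)
    have "equiv (carrier M) (\<Inter>A)"
    proof (rule equivI)
      show "\<Inter>A \<subseteq> carrier M \<times> carrier M"
        using A(2) c by (fastforce simp: congruence_on_def equiv_def)
      show "refl_on (carrier M) (\<Inter>A)"
        using c by (auto simp: congruence_on_def equiv_def refl_on_def)
      show "sym (\<Inter>A)"
        using c by (auto simp: congruence_on_def equiv_def sym_def)
      show "trans (\<Inter>A)"
        by (rule transI) (use c in \<open>auto simp: congruence_on_def equiv_def dest: transD\<close>)
    qed
    moreover have "(x \<otimes> u, y \<otimes> v) \<in> \<Inter>A" if "(x, y) \<in> \<Inter>A" "(u, v) \<in> \<Inter>A" for x y u v
      using c that by (fastforce simp: congruence_on_def)
    ultimately have "congruence_on M (\<Inter>A)"
      unfolding congruence_on_def by blast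
    then have "greatest (Cong M) (\<Inter>A) (Lower (Cong M) A)"
      using A(1) by (auto simp: greatest_def Lower_def Cong_def)
    then show "\<exists>i. greatest (Cong M) i (Lower (Cong M) A)" ..
  qed
qed

lemma equiv_rtrancl_product_edges: "equiv UNIV ((product_edges \<alpha> \<beta>)\<^sup>*)"
  by (intro equivI refl_rtrancl trans_rtrancl sym_rtrancl)
     (auto simp: product_edges_def sym_def)

lemma partition_mult_closed: "partition_mult n \<alpha> \<beta> \<in> partitions n"
proof -
  have "equiv (boundary n)
      {(x, y) \<in> boundary n \<times> boundary n. (x, y) \<in> (product_edges \<alpha> \<beta>)\<^sup>*}"
    using equiv_rtrancl_product_edges[of \<alpha> \<beta>]
    by (intro equivI) (auto simp: equiv_def refl_on_def sym_def intro!: transI)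
  then show ?thesis
    by (simp add: partitions_def partition_mult_def partition_on_quotient)
qed

lemma complete_lattice_Cong_twisted_partition_monoid:
  "complete_lattice (Cong (twisted_partition_monoid n))"
  by (rule complete_lattice_Cong)
     (auto simp: twisted_partition_monoid_def partition_mult_closed)


section \<open>Sublattices, diamonds and pentagons\<close>

definition sublattice_of :: "'a set \<Rightarrow> ('a, 'b) gorder_scheme \<Rightarrow> bool" where
  "sublattice_of S L \<longleftrightarrow> S \<subseteq> carrier L \<and>
     (\<forall>x\<in>S. \<forall>y\<in>S. x \<sqinter>\<^bsub>L\<^esub> y \<in> S \<and> x \<squnion>\<^bsub>L\<^esub> y \<in> S)"

definition incomparable :: "('a, 'b) gorder_scheme \<Rightarrow> 'a \<Rightarrow> 'a \<Rightarrow> bool" where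
  "incomparable L x y \<longleftrightarrow> \<not> x \<sqsubseteq>\<^bsub>L\<^esub> y \<and> \<not> y \<sqsubseteq>\<^bsub>L\<^esub> x"

definition is_diamond :: "('a, 'b) gorder_scheme \<Rightarrow> bool" where
  "is_diamond L \<longleftrightarrow> (\<exists>z a b c t.
     distinct [z, a, b, c, t] \<and> carrier L = {z, a, b, c, t} \<and>
     (\<forall>x\<in>carrier L. z \<sqsubseteq>\<^bsub>L\<^esub> x \<and> x \<sqsubseteq>\<^bsub>L\<^esub> t) \<and>
     incomparable L a b \<and> incomparable L a c \<and> incomparable L b c)"

definition is_pentagon :: "('a, 'b) gorder_scheme \<Rightarrow> bool" where
  "is_pentagon L \<longleftrightarrow> (\<exists>z a b c t.
     distinct [z, a, b, c, t] \<and> carrier L = {z, a, b, c, t} \<and>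
     z \<sqsubset>\<^bsub>L\<^esub> b \<and> b \<sqsubset>\<^bsub>L\<^esub> c \<and> c \<sqsubset>\<^bsub>L\<^esub> t \<and> z \<sqsubset>\<^bsub>L\<^esub> a \<and> a \<sqsubset>\<^bsub>L\<^esub> t \<and>
     incomparable L a b \<and> incomparable L a c)"

definition contains_diamond :: "('a, 'b) gorder_scheme \<Rightarrow> bool" where
  "contains_diamond L \<longleftrightarrow> (\<exists>S. sublattice_of S L \<and> is_diamond (L\<lparr>carrier := S\<rparr>))"

definition contains_pentagon :: "('a, 'b) gorder_scheme \<Rightarrow> bool" where
  "contains_pentagon L \<longleftrightarrow> (\<exists>S. sublattice_of S L \<and> is_pentagon (L\<lparr>carrier := S\<rparr>))"

text \<open>The following two notions are meant for lattices only; being a lattice is not part of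
  them, so that their negations say nothing about the existence of meets and joins.\<close>

definition modular :: "('a, 'b) gorder_scheme \<Rightarrow> bool" where
  "modular L \<longleftrightarrow> (\<forall>x\<in>carrier L. \<forall>y\<in>carrier L. \<forall>z\<in>carrier L.
     x \<sqsubseteq>\<^bsub>L\<^esub> z \<longrightarrow> x \<squnion>\<^bsub>L\<^esub> (y \<sqinter>\<^bsub>L\<^esub> z) = (x \<squnion>\<^bsub>L\<^esub> y) \<sqinter>\<^bsub>L\<^esub> z)"

definition distributive :: "('a, 'b) gorder_scheme \<Rightarrow> bool" where
  "distributive L \<longleftrightarrow> (\<forall>x\<in>carrier L. \<forall>y\<in>carrier L. \<forall>z\<in>carrier L.
     x \<sqinter>\<^bsub>L\<^esub> (y \<squnion>\<^bsub>L\<^esub> z) = (x \<sqinter>\<^bsub>L\<^esub> y) \<squnion>\<^bsub>L\<^esub> (x \<sqinter>\<^bsub>L\<^esub> z))"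

end

theory Submission
  imports Defs
begin

text \<open>Write $\hat\alpha$ for the partition obtained from $\alpha$ by cutting its transversal
  blocks into upper and lower parts. On the ideal $J$ of elements of rank at most one, the map
  $F(i,\alpha) = (i,\hat\alpha)$ in rank one and $F(i,\alpha) = (i+1,\alpha)$ in rank zero
  commutes with all translations: the half of a transversal block that is cut off forms a floating
  component exactly when the transversal does not survive in the product. Call the first
  coordinate of $F$ the level; it never decreases under translations.

  Pentagon: the kernels of $F$ restricted to levels $\ge 2$ and $\ge 1$ are the chain $b < c$, and
  $a$ relates $(i,\alpha)$ to all $(j,\alpha)$. As $F$ determines $i$ from $\alpha$,
  $a \cap c$ is trivial; shifting the first coordinate up by means of $a$ yields
  $c \subseteq a \vee b$.

  Diamond: modulo levels $\ge 2$, the rank-one elements $X$ and the rank-zero elements $Y$ of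
  level one become ``parallel'' layers: collapse $X$ into the ideal, or $Y$ into the ideal, or
  identify $X$ with $Y$ along $F$ (in each case identifying elements of $X$ with equal $F$).\<close>

section \<open>Diamonds and pentagons in lattices\<close>

context lattice
begin

text \<open>As \<open>b\<close> lies between \<open>a \<sqinter> c\<close> and \<open>c\<close>, and
  \<open>c\<close> between \<open>b\<close> and \<open>a \<squnion> b\<close>, the elements
  \<open>b\<close> and \<open>c\<close> have the same meet and the same join with \<open>a\<close>.
  Stated by inequalities, the criterion spares an explicit computation of the join of two
  congruences.\<close>

lemma contains_pentagon_criterion:
  assumes carr: "a \<in> carrier L" "b \<in> carrier L" "c \<in> carrier L"
    and bc: "b \<sqsubset> c" and meet: "a \<sqinter> c \<sqsubseteq> b" and join: "c \<sqsubseteq> a \<squnion> b"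
  shows "contains_pentagon L" "\<not> modular L" "\<not> distributive L"
proof -
  define z where "z = a \<sqinter> c"
  define t where "t = a \<squnion> b"
  note carr' = carr meet_closed[OF carr(1,3)] join_closed[OF carr(1,2)]
  have zt: "z \<in> carrier L" "t \<in> carrier L"
    using carr' by (auto simp: z_def t_def)
  have le: "b \<sqsubseteq> c" "b \<noteq> c" using bc by (auto simp: lless_def eq_is_equal)
  have ncb: "\<not> c \<sqsubseteq> b" using le carr le_antisym by blast
  have za: "z \<sqsubseteq> a" and zc: "z \<sqsubseteq> c" and zb: "z \<sqsubseteq> b"
    using meet_left meet_right carr meet by (auto simp: z_def)
  have at: "a \<sqsubseteq> t" and bt: "b \<sqsubseteq> t" and ct: "c \<sqsubseteq> t"
    using join_left join_right carr join by (auto simp: t_def)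
  have z_greatest: "x \<sqsubseteq> z" if "x \<sqsubseteq> a" "x \<sqsubseteq> c" "x \<in> carrier L" for x
    using that carr meet_le by (auto simp: z_def)
  have t_least: "t \<sqsubseteq> x" if "a \<sqsubseteq> x" "b \<sqsubseteq> x" "x \<in> carrier L" for x
    using that carr join_le by (auto simp: t_def)
  \<comment> \<open>If \<open>a \<sqsubseteq> c\<close>, then
    \<open>a \<sqsubseteq> z \<sqsubseteq> b\<close>, hence
    \<open>c \<sqsubseteq> t \<sqsubseteq> b\<close>, contrary to \<open>b \<sqsubset> c\<close>.
    The argument for \<open>ba\<close> is dual.\<close>
  have ac: "\<not> a \<sqsubseteq> c"
    using z_greatest[of a] t_least[of b] zb ct ncb carr zt le_trans le_refl by metis
  have ba: "\<not> b \<sqsubseteq> a"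
    using z_greatest[of c] t_least[of a] zb ct ncb carr zt le_trans le_refl by metis
  have ab: "\<not> a \<sqsubseteq> b" using ac le carr le_trans by blast
  have ca: "\<not> c \<sqsubseteq> a" using ba le carr le_trans by blast
  have meet_eqI: "x \<sqinter> y = w"
    if "w \<sqsubseteq> x" "w \<sqsubseteq> y" "\<And>v. v \<in> carrier L \<Longrightarrow> v \<sqsubseteq> x \<Longrightarrow> v \<sqsubseteq> y \<Longrightarrow> v \<sqsubseteq> w"
      "x \<in> carrier L" "y \<in> carrier L" "w \<in> carrier L" for x y w
    using that meet_closed[of x y] meet_left[of x y] meet_right[of x y] meet_le[of w x y]
    by (intro le_antisym) auto
  have join_eqI: "x \<squnion> y = w"
    if "x \<sqsubseteq> w" "y \<sqsubseteq> w" "\<And>v. v \<in> carrier L \<Longrightarrow> x \<sqsubseteq> v \<Longrightarrow> y \<sqsubseteq> v \<Longrightarrow> w \<sqsubseteq> v"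
      "x \<in> carrier L" "y \<in> carrier L" "w \<in> carrier L" for x y w
    using that join_closed[of x y] join_left[of x y] join_right[of x y] join_le[of x w y]
    by (intro le_antisym) auto
  have chain: "x \<sqinter> y = x" "y \<sqinter> x = x" "x \<squnion> y = y" "y \<squnion> x = y"
    if "x \<sqsubseteq> y" "x \<in> carrier L" "y \<in> carrier L" for x y
    using that by (auto intro!: meet_eqI join_eqI)
  have ab_ac: "a \<sqinter> b = z" "b \<sqinter> a = z" "a \<sqinter> c = z" "c \<sqinter> a = z"
    using za zb zc z_greatest carr zt le
    by (auto intro!: meet_eqI intro: z_greatest le_trans[OF _ le(1)])
  have ab_ac': "a \<squnion> b = t" "b \<squnion> a = t" "a \<squnion> c = t" "c \<squnion> a = t"
    using at bt ct t_least carr zt le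
    by (auto intro!: join_eqI intro: t_least le_trans[OF le(1)])
  have trivial: "z \<sqsubseteq> t" using za at zt carr le_trans by blast
  note order = za zb zc at bt ct le(1) trivial
  show "contains_pentagon L"
    unfolding contains_pentagon_def
  proof (intro exI conjI)
    show "sublattice_of {z, a, b, c, t} L"
      unfolding sublattice_of_def
      using carr zt chain order le_refl ab_ac ab_ac' by simp
    have "z \<noteq> t" using le_trans[of a t b] at zb ab carr zt by auto
    then have "distinct [z, a, b, c, t]"
      using ab ac ba ca ncb order le_refl[of a] le_refl[of b] le_refl[of c] carr by auto
    then show "is_pentagon (L\<lparr>carrier := {z, a, b, c, t}\<rparr>)"
      unfolding is_pentagon_def
      using order ab ac ba ca
      by (intro exI[of _ z] exI[of _ a] exI[of _ b] exI[of _ c] exI[of _ t])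
        (simp add: incomparable_def lless_def eq_is_equal)
  qed
  \<comment> \<open>The two sides are \<open>b \<squnion> z = b\<close> and
    \<open>t \<sqinter> c = c\<close>; the failure of distributivity below compares the same two
    elements.\<close>
  have "b \<squnion> (a \<sqinter> c) \<noteq> (b \<squnion> a) \<sqinter> c"
    using chain order ab_ac ab_ac' le carr zt by metis
  then show "\<not> modular L"
    using carr le unfolding modular_def by blast
  have "c \<sqinter> (a \<squnion> b) \<noteq> (c \<sqinter> a) \<squnion> (c \<sqinter> b)"
    using chain order ab_ac ab_ac' le carr zt by metis
  then show "\<not> distributive L"
    using carr le unfolding distributive_def by blast
qed

text \<open>If two of the three elements were comparable, they would be \<open>z\<close> and
  \<open>t\<close>, and the third would then equal both. So \<open>z \<noteq> t\<close> secures all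
  the incomparabilities.\<close>

lemma contains_diamond_criterion:
  assumes carr: "a \<in> carrier L" "b \<in> carrier L" "c \<in> carrier L"
    and meets: "a \<sqinter> b = z" "a \<sqinter> c = z" "b \<sqinter> c = z"
    and joins: "a \<squnion> b = t" "a \<squnion> c = t" "b \<squnion> c = t"
    and "z \<noteq> t"
  shows "contains_diamond L"
proof -
  have zt: "z \<in> carrier L" "t \<in> carrier L"
    using carr meets joins meet_closed join_closed by auto
  note order = meet_left[OF carr(1,2)] meet_right[OF carr(1,2)] meet_right[OF carr(2,3)]
    join_left[OF carr(1,2)] join_right[OF carr(1,2)] join_right[OF carr(2,3)]
  note order = order[unfolded meets joins]
  have trivial: "z \<sqsubseteq> t" using order zt carr le_trans by blast
  note order = order trivial
  have chain: "x \<sqinter> y = x" "x \<squnion> y = y"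
    if "x \<sqsubseteq> y" "x \<in> carrier L" "y \<in> carrier L" for x y
    using that meet_closed[of x y] meet_left[of x y] meet_le[of x x y]
      join_closed[of x y] join_right[of x y] join_le[of x y y] le_antisym[of "x \<sqinter> y" x]
      le_antisym[of "x \<squnion> y" y] le_refl
    by auto
  have sym: "b \<sqinter> a = z" "c \<sqinter> a = z" "c \<sqinter> b = z" "b \<squnion> a = t" "c \<squnion> a = t" "c \<squnion> b = t"
    using meets joins meet_comm[of L a b] meet_comm[of L a c] meet_comm[of L b c]
      join_comm[of L a b] join_comm[of L a c] join_comm[of L b c] by simp_all
  have incomp: "\<not> x \<sqsubseteq> y"
    if "x \<in> carrier L" "y \<in> carrier L" "w \<in> carrier L"
      "x \<sqinter> y = z" "x \<sqinter> w = z" "y \<sqinter> w = z" "x \<squnion> y = t" "x \<squnion> w = t" "y \<squnion> w = t" for x y w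
  proof
    assume "x \<sqsubseteq> y"
    then have "x = z" "y = t" using chain[of x y] that by auto
    moreover have "w \<sqsubseteq> t" using join_right[of x w] that by auto
    moreover have "z \<sqsubseteq> w" using meet_right[of x w] that by auto
    ultimately show False
      using chain(1)[of w t] chain(2)[of z w] meet_comm[of L w t] that zt \<open>z \<noteq> t\<close> by simp
  qed
  have inc: "\<not> a \<sqsubseteq> b" "\<not> b \<sqsubseteq> a" "\<not> a \<sqsubseteq> c" "\<not> c \<sqsubseteq> a" "\<not> b \<sqsubseteq> c" "\<not> c \<sqsubseteq> b"
    using incomp[of a b c] incomp[of b a c] incomp[of a c b] incomp[of c a b]
      incomp[of b c a] incomp[of c b a] carr meets joins sym by simp_all
  show ?thesis
    unfolding contains_diamond_def
  proof (intro exI conjI)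
    have chain': "y \<sqinter> x = x" "y \<squnion> x = y"
      if "x \<sqsubseteq> y" "x \<in> carrier L" "y \<in> carrier L" for x y
      using chain[OF that] meet_comm[of L x y] join_comm[of L x y] by simp_all
    show "sublattice_of {z, a, b, c, t} L"
      unfolding sublattice_of_def
      using carr zt chain chain' order le_refl meets joins sym by simp
    have "distinct [z, a, b, c, t]"
      using inc order \<open>z \<noteq> t\<close> le_refl carr zt by auto
    then show "is_diamond (L\<lparr>carrier := {z, a, b, c, t}\<rparr>)"
      unfolding is_diamond_def
      using order inc zt
      by (intro exI[of _ z] exI[of _ a] exI[of _ b] exI[of _ c] exI[of _ t])
        (simp add: incomparable_def)
  qed
qed

end

section \<open>Congruences\<close>

locale magma =
  fixes M (structure)
  assumes closed: "\<And>x y. x \<in> carrier M \<Longrightarrow> y \<in> carrier M \<Longrightarrow> x \<otimes> y \<in> carrier M"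
begin

sublocale Cong: complete_lattice "Cong M"
  by (rule complete_lattice_Cong) (rule closed)

lemma carrier_Cong [simp]: "r \<in> carrier (Cong M) \<longleftrightarrow> congruence_on M r"
  by (simp add: Cong_def)

lemma le_Cong [simp]: "r \<sqsubseteq>\<^bsub>Cong M\<^esub> s \<longleftrightarrow> r \<subseteq> s"
  by (simp add: Cong_def)

text \<open>Two translations lead from \<open>x \<otimes> u\<close> through
  \<open>y \<otimes> u\<close> to \<open>y \<otimes> v\<close>, so it suffices to study translations
  from here on.\<close>

lemma congruence_onI:
  assumes "equiv (carrier M) r"
    and "\<And>x y u. (x, y) \<in> r \<Longrightarrow> u \<in> carrier M \<Longrightarrow> (x \<otimes> u, y \<otimes> u) \<in> r"
    and "\<And>x y u. (x, y) \<in> r \<Longrightarrow> u \<in> carrier M \<Longrightarrow> (u \<otimes> x, u \<otimes> y) \<in> r"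
  shows "congruence_on M r"
proof -
  have "(x \<otimes> u, y \<otimes> v) \<in> r" if "(x, y) \<in> r" "(u, v) \<in> r" for x y u v
  proof -
    have "u \<in> carrier M" "y \<in> carrier M"
      using that assms(1) by (auto simp: equiv_def)
    then have "(x \<otimes> u, y \<otimes> u) \<in> r" "(y \<otimes> u, y \<otimes> v) \<in> r"
      using that assms(2,3) by blast+
    then show ?thesis using assms(1) by (meson equivE transD)
  qed
  then show ?thesis using assms(1) unfolding congruence_on_def by blast
qed

lemma congruence_on_Int:
  assumes "congruence_on M r" "congruence_on M s"
  shows "congruence_on M (r \<inter> s)"
proof (rule congruence_onI)
  have c: "equiv (carrier M) r" "equiv (carrier M) s"
    using assms by (auto simp: congruence_on_def)
  then show "equiv (carrier M) (r \<inter> s)"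
    by (auto simp: equiv_def refl_on_def intro: sym_Int trans_Int)
  fix x y u assume xy: "(x, y) \<in> r \<inter> s" and "u \<in> carrier M"
  then have "(u, u) \<in> r" "(u, u) \<in> s"
    using c by (auto simp: equiv_def refl_on_def)
  then show "(x \<otimes> u, y \<otimes> u) \<in> r \<inter> s" "(u \<otimes> x, u \<otimes> y) \<in> r \<inter> s"
    using xy assms unfolding congruence_on_def by blast+
qed

lemma meet_Cong:
  assumes "congruence_on M r" "congruence_on M s"
  shows "r \<sqinter>\<^bsub>Cong M\<^esub> s = r \<inter> s"
proof (rule Cong.le_antisym)
  show "r \<sqinter>\<^bsub>Cong M\<^esub> s \<sqsubseteq>\<^bsub>Cong M\<^esub> r \<inter> s"
    using Cong.meet_left[of r s] Cong.meet_right[of r s] assms by auto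
  show "r \<inter> s \<sqsubseteq>\<^bsub>Cong M\<^esub> r \<sqinter>\<^bsub>Cong M\<^esub> s"
    using assms congruence_on_Int by (intro Cong.meet_le) auto
qed (use assms congruence_on_Int[OF assms] Cong.meet_closed[of r s] in simp_all)

text \<open>The join in \<open>Cong M\<close> is itself an equivalence containing \<open>r\<close>
  and \<open>s\<close>, so leastness of \<open>t\<close> may be tested against bare equivalences
  \<open>q\<close>. Checking it then involves no products.\<close>

lemma join_Cong_eqI:
  assumes "congruence_on M r" "congruence_on M s" "congruence_on M t" "r \<subseteq> t" "s \<subseteq> t"
    and "\<And>q. equiv (carrier M) q \<Longrightarrow> r \<subseteq> q \<Longrightarrow> s \<subseteq> q \<Longrightarrow> t \<subseteq> q"
  shows "r \<squnion>\<^bsub>Cong M\<^esub> s = t"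
proof (rule Cong.le_antisym)
  have "congruence_on M (r \<squnion>\<^bsub>Cong M\<^esub> s)"
    using Cong.join_closed[of r s] assms by simp
  then show "t \<sqsubseteq>\<^bsub>Cong M\<^esub> r \<squnion>\<^bsub>Cong M\<^esub> s"
    using Cong.join_left[of r s] Cong.join_right[of r s] assms(1,2,6)
    by (simp add: congruence_on_def)
  show "r \<squnion>\<^bsub>Cong M\<^esub> s \<sqsubseteq>\<^bsub>Cong M\<^esub> t"
    using assms by (intro Cong.join_le) auto
qed (use assms(1-3) Cong.join_closed[of r s] in simp_all)

end

text \<open>An ideal \<open>A\<close> with empty \<open>H\<close> gives a Rees congruence; an empty
  \<open>A\<close> gives the kernel of \<open>f\<close> on \<open>H\<close>, extended by equality.
  The congruences below mix both kinds.\<close>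

definition glue :: "'a set \<Rightarrow> 'a set \<Rightarrow> 'a set \<Rightarrow> ('a \<Rightarrow> 'b) \<Rightarrow> 'a rel" where
  "glue S A H f = Id_on S \<union> A \<times> A \<union> {(x, y) \<in> H \<times> H. f x = f y}"

lemma equiv_glue:
  assumes "A \<subseteq> S" "H \<subseteq> S" "A \<inter> H = {}"
  shows "equiv S (glue S A H f)"
proof (rule equivI)
  show "glue S A H f \<subseteq> S \<times> S" "refl_on S (glue S A H f)" "sym (glue S A H f)"
    using assms by (auto simp: glue_def refl_on_def sym_def)
  show "trans (glue S A H f)"
    using assms by (intro transI) (auto simp: glue_def)
qed

text \<open>A translation takes an \<open>f\<close>-equal pair in \<open>H\<close> to an
  \<open>f\<close>-equal pair in \<open>H \<union> I\<close>. As \<open>f\<close> separates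
  \<open>H\<close> from \<open>I\<close>, the images either both stay in \<open>H\<close> or both
  fall into \<open>I\<close>, a part of the class \<open>A\<close>. The set \<open>I\<close> is kept
  distinct from \<open>A\<close> because \<open>f\<close> may share values between \<open>H\<close>
  and the rest of \<open>A\<close>.\<close>

lemma (in magma) congruence_on_glue:
  assumes "A \<subseteq> carrier M" "H \<subseteq> carrier M" "A \<inter> H = {}" "I \<subseteq> A"
    and A: "\<And>x u. x \<in> A \<Longrightarrow> u \<in> carrier M \<Longrightarrow> x \<otimes> u \<in> A \<and> u \<otimes> x \<in> A"
    and H: "\<And>x u. x \<in> H \<Longrightarrow> u \<in> carrier M \<Longrightarrow> x \<otimes> u \<in> H \<union> I \<and> u \<otimes> x \<in> H \<union> I"
    and I: "\<And>x y. x \<in> H \<Longrightarrow> y \<in> I \<Longrightarrow> f x \<noteq> f y"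
    and f: "\<And>x y u. x \<in> H \<Longrightarrow> y \<in> H \<Longrightarrow> f x = f y \<Longrightarrow> u \<in> carrier M \<Longrightarrow>
      f (x \<otimes> u) = f (y \<otimes> u) \<and> f (u \<otimes> x) = f (u \<otimes> y)"
  shows "congruence_on M (glue (carrier M) A H f)"
proof (rule congruence_onI)
  have *: "(p, q) \<in> glue (carrier M) A H f" if "p \<in> H \<union> I" "q \<in> H \<union> I" "f p = f q" for p q
    using that I[of p q] I[of q p] \<open>I \<subseteq> A\<close> by (auto simp: glue_def)
  fix x y u
  assume "(x, y) \<in> glue (carrier M) A H f" and u: "u \<in> carrier M"
  then consider "x = y" "x \<in> carrier M" | "x \<in> A" "y \<in> A" | "x \<in> H" "y \<in> H" "f x = f y"
    by (auto simp: glue_def)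
  then have "(x \<otimes> u, y \<otimes> u) \<in> glue (carrier M) A H f \<and> (u \<otimes> x, u \<otimes> y) \<in> glue (carrier M) A H f"
  proof cases
    case 1
    then show ?thesis using closed u by (simp add: glue_def Id_on_iff)
  next
    case 2
    then show ?thesis using A[OF _ u] by (simp add: glue_def)
  next
    case 3
    then show ?thesis using H[OF _ u] f[OF 3 u] by (simp add: *)
  qed
  then show "(x \<otimes> u, y \<otimes> u) \<in> glue (carrier M) A H f"
    "(u \<otimes> x, u \<otimes> y) \<in> glue (carrier M) A H f" by simp_all
qed (rule equiv_glue[OF assms(1-3)])

section \<open>Cutting a graph along a single class of edges\<close>

text \<open>This models a product graph in which one factor has at most one transversal block. The
  set \<open>U\<close> is the outer row of that factor, and \<open>cross\<close> reflects that all
  edges leaving \<open>U\<close> stem from a single block, whose vertices are pairwise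
  adjacent.\<close>

locale cut_graph =
  fixes E :: "'a rel" and U :: "'a set"
  assumes sym_E: "sym E"
    and cross: "\<And>x y x' y'. (x, y) \<in> E \<Longrightarrow> (x', y') \<in> E \<Longrightarrow> x \<in> U \<Longrightarrow> x' \<in> U \<Longrightarrow> y \<notin> U \<Longrightarrow> y' \<notin> U
      \<Longrightarrow> (x, x') \<in> E \<and> (y, y') \<in> E"
begin

definition E' :: "'a rel" where "E' = {(x, y) \<in> E. x \<in> U \<longleftrightarrow> y \<in> U}"

lemma E'_sub: "E'\<^sup>* \<subseteq> E\<^sup>*"
  by (rule rtrancl_mono) (auto simp: E'_def)

lemma sym_E': "(x, y) \<in> E'\<^sup>* \<Longrightarrow> (y, x) \<in> E'\<^sup>*"
proof -
  have "sym E'" using sym_E by (auto simp: E'_def sym_def)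
  then show "(x, y) \<in> E'\<^sup>* \<Longrightarrow> (y, x) \<in> E'\<^sup>*" by (meson sym_rtrancl symD)
qed

lemma E'_class: "(x, y) \<in> E'\<^sup>* \<Longrightarrow> E'\<^sup>* `` {x} = E'\<^sup>* `` {y}"
  using rtrancl_trans[of x y E'] rtrancl_trans[of y x E'] sym_E'[of x y] by blast

lemma sym_E_rtrancl: "(x, y) \<in> E\<^sup>* \<Longrightarrow> (y, x) \<in> E\<^sup>*"
  using sym_E by (meson sym_rtrancl symD)

lemma E'_side: "(x, y) \<in> E'\<^sup>* \<Longrightarrow> x \<in> U \<longleftrightarrow> y \<in> U"
  by (induction rule: rtrancl_induct) (auto simp: E'_def)

lemma cross_E':
  assumes "(x, y) \<in> E" "(x', y') \<in> E" "x \<in> U \<longleftrightarrow> y \<notin> U" "x' \<in> U \<longleftrightarrow> y' \<notin> U" "x \<in> U \<longleftrightarrow> x' \<in> U"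
  shows "(x, x') \<in> E'" "(y, y') \<in> E'"
proof -
  have "(y, x) \<in> E" "(y', x') \<in> E" using assms sym_E by (auto dest: symD)
  then show "(x, x') \<in> E'" "(y, y') \<in> E'"
    using assms cross[of x y x' y'] cross[of y x y' x'] by (auto simp: E'_def)
qed

text \<open>A path that leaves its side and comes back can be shortened: by \<open>cross\<close>,
  the vertices where it departs and returns are adjacent. Hence at most one crossing edge is
  needed.\<close>

lemma rtrancl_E_cases:
  assumes "(x, y) \<in> E\<^sup>*"
  shows "if x \<in> U \<longleftrightarrow> y \<in> U then (x, y) \<in> E'\<^sup>* else
    \<exists>d t. (d, t) \<in> E \<and> (d \<in> U \<longleftrightarrow> t \<notin> U) \<and> (x, d) \<in> E'\<^sup>* \<and> (t, y) \<in> E'\<^sup>*"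
  using assms
proof (induction rule: rtrancl_induct)
  case base
  then show ?case by simp
next
  case (step y z)
  show ?case
  proof (cases "x \<in> U \<longleftrightarrow> y \<in> U")
    case True
    then have xy: "(x, y) \<in> E'\<^sup>*" using step.IH by simp
    show ?thesis
    proof (cases "y \<in> U \<longleftrightarrow> z \<in> U")
      case True
      then have "(y, z) \<in> E'" using step.hyps by (auto simp: E'_def)
      with xy True \<open>x \<in> U \<longleftrightarrow> y \<in> U\<close> show ?thesis by auto
    next
      case False
      with xy True step.hyps show ?thesis by auto
    qed
  next
    case False
    then obtain d t where dt: "(d, t) \<in> E" "d \<in> U \<longleftrightarrow> t \<notin> U" "(x, d) \<in> E'\<^sup>*" "(t, y) \<in> E'\<^sup>*"
      using step.IH by auto
    show ?thesis
    proof (cases "y \<in> U \<longleftrightarrow> z \<in> U")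
      case True
      then have "(y, z) \<in> E'" using step.hyps by (auto simp: E'_def)
      with dt True False show ?thesis by (auto intro: rtrancl_into_rtrancl)
    next
      case F: False
      \<comment> \<open>The path crosses a second time. Reversed, this edge runs in the same
        direction as \<open>(d, t)\<close>, so \<open>d\<close> and \<open>z\<close> are adjacent
        and the two crossings cancel.\<close>
      have "(z, y) \<in> E" using step.hyps sym_E by (auto dest: symD)
      then have "(d, z) \<in> E'"
        using cross_E'(1)[of d t z y] dt F False E'_side[OF dt(3)] by auto
      with dt F False show ?thesis by (auto intro: rtrancl_into_rtrancl)
    qed
  qed
qed

text \<open>A path with both ends on one side needs no crossing edge, so the deletion separates
  nothing but the two sides from each other.\<close>

lemma E'_rtrancl: "E'\<^sup>* = {(x, y) \<in> E\<^sup>*. x \<in> U \<longleftrightarrow> y \<in> U}"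
proof -
  have "(x, y) \<in> E'\<^sup>* \<longleftrightarrow> (x, y) \<in> E\<^sup>* \<and> (x \<in> U \<longleftrightarrow> y \<in> U)" for x y
    using E'_sub E'_side[of x y] rtrancl_E_cases[of x y] by (cases "x \<in> U \<longleftrightarrow> y \<in> U") auto
  then show ?thesis by auto
qed

lemma crossing_path:
  assumes "(x, y) \<in> E\<^sup>*" "x \<in> U" "y \<notin> U"
  obtains d t where "(d, t) \<in> E" "d \<in> U" "t \<notin> U" "(x, d) \<in> E'\<^sup>*" "(t, y) \<in> E'\<^sup>*"
proof -
  obtain d t where dt: "(d, t) \<in> E" "d \<in> U \<longleftrightarrow> t \<notin> U" "(x, d) \<in> E'\<^sup>*" "(t, y) \<in> E'\<^sup>*"
    using rtrancl_E_cases[OF assms(1)] assms by auto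
  with E'_side[OF dt(3)] assms that show thesis by blast
qed

text \<open>Each path uses a crossing edge, and the ends of these edges in \<open>U\<close> are
  adjacent. This bounds the rank of products.\<close>

lemma crossing_paths_connected:
  assumes "(x, y) \<in> E\<^sup>*" "x \<in> U" "y \<notin> U" "(x', y') \<in> E\<^sup>*" "x' \<in> U" "y' \<notin> U"
  shows "(x, x') \<in> E\<^sup>*"
proof -
  obtain d t where dt: "(d, t) \<in> E" "d \<in> U" "t \<notin> U" "(x, d) \<in> E'\<^sup>*"
    using crossing_path[OF assms(1-3)] by blast
  obtain d' t' where dt': "(d', t') \<in> E" "d' \<in> U" "t' \<notin> U" "(x', d') \<in> E'\<^sup>*"
    using crossing_path[OF assms(4-6)] by blast
  have "(d, d') \<in> E'" using cross_E'(1)[of d t d' t'] dt dt' by auto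
  then have "(x, x') \<in> E'\<^sup>*"
    using dt(4) sym_E'[OF dt'(4)] by (meson rtrancl_into_rtrancl rtrancl_trans)
  then show ?thesis using E'_sub by blast
qed

text \<open>Later \<open>N\<close> is the middle row and \<open>W\<close> the outer row opposite
  \<open>U\<close>. Components inside \<open>N\<close> that exist before the cut avoid
  \<open>U\<close> and are unaffected. All far ends of crossing edges lie in one component of the
  cut graph; this is the only one that can be new inside \<open>N\<close>, and it lies in
  \<open>N\<close> exactly when no path from \<open>U\<close> reaches \<open>W\<close>.\<close>

lemma card_components_cut:
  assumes V: "finite V" "E \<subseteq> V \<times> V" "V \<subseteq> U \<union> N \<union> W" "N \<inter> U = {}" "N \<inter> W = {}" "W \<inter> U = {}"
  shows "card {C \<in> V // E'\<^sup>*. C \<subseteq> N} = card {C \<in> V // E\<^sup>*. C \<subseteq> N} +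
    (if (\<exists>d\<in>U. \<exists>t. t \<notin> U \<and> (d, t) \<in> E) \<and> \<not> (\<exists>x\<in>U. \<exists>y\<in>W. (x, y) \<in> E\<^sup>*) then 1 else 0)"
proof -
  have fin: "finite {C \<in> V // E\<^sup>*. C \<subseteq> N}"
    using V(1) by (simp add: quotient_def)
  have V_closed: "y \<in> V" if "(x, y) \<in> E\<^sup>*" "x \<in> V" for x y
    using that V(2) by (induction rule: rtrancl_induct) auto
  have same: "E'\<^sup>* `` {x} = E\<^sup>* `` {x}" if "x \<notin> U" "E\<^sup>* `` {x} \<inter> U = {}" for x
    using that by (auto simp: E'_rtrancl)
  have old: "C \<in> V // E'\<^sup>*" if C: "C \<in> V // E\<^sup>*" "C \<subseteq> N" for C
  proof -
    obtain x where x: "x \<in> V" "C = E\<^sup>* `` {x}" using C by (auto simp: quotient_def)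
    then have "C = E'\<^sup>* `` {x}" using same[of x] that V(4) by blast
    with quotientI[OF x(1), of "E'\<^sup>*"] show ?thesis by simp
  qed
  have new: "C \<in> V // E\<^sup>* \<or> (\<exists>d t. (d, t) \<in> E \<and> d \<in> U \<and> t \<notin> U \<and> C = E'\<^sup>* `` {t}) \<and>
      \<not> (\<exists>x\<in>U. \<exists>y\<in>W. (x, y) \<in> E\<^sup>*)" if C: "C \<in> V // E'\<^sup>*" "C \<subseteq> N" for C
  proof -
    obtain x where x: "x \<in> V" "C = E'\<^sup>* `` {x}" using C by (auto simp: quotient_def)
    then have "x \<in> N" using that by auto
    then have xU: "x \<notin> U" using V by auto
    show ?thesis
    proof (cases "E\<^sup>* `` {x} \<inter> U = {}")
      case True
      then have "C = E\<^sup>* `` {x}" using same[OF xU] x by simp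
      then show ?thesis using quotientI[OF x(1), of "E\<^sup>*"] by simp
    next
      case False
      then obtain u where u: "u \<in> U" "(u, x) \<in> E\<^sup>*" using sym_E_rtrancl by auto
      obtain d t where dt: "(d, t) \<in> E" "d \<in> U" "t \<notin> U" "(t, x) \<in> E'\<^sup>*"
        using crossing_path[OF u(2,1) xU] by blast
      have C: "C = E'\<^sup>* `` {t}"
        using E'_class[OF dt(4)] x by simp
      \<comment> \<open>A path from \<open>U\<close> to \<open>W\<close> crosses into the component
        \<open>C\<close> of \<open>t\<close>, which would put an element of \<open>W\<close> into
        \<open>C \<subseteq> N\<close>.\<close>
      have "y \<in> C" if xy: "p \<in> U" "y \<in> W" "(p, y) \<in> E\<^sup>*" for p y
      proof -
        have yU: "y \<notin> U" using xy(2) V(6) by blast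
        obtain d' t' where dt': "(d', t') \<in> E" "d' \<in> U" "t' \<notin> U" "(t', y) \<in> E'\<^sup>*"
          using crossing_path[OF xy(3,1) yU] by blast
        have "(t, t') \<in> E'" using cross_E'(2)[of d t d' t'] dt dt' by auto
        then show ?thesis using converse_rtrancl_into_rtrancl[OF _ dt'(4)] C by simp
      qed
      then show ?thesis using C dt \<open>C \<subseteq> N\<close> V(5) by blast
    qed
  qed
  show ?thesis
  proof (cases "(\<exists>d\<in>U. \<exists>t. t \<notin> U \<and> (d, t) \<in> E) \<and> \<not> (\<exists>x\<in>U. \<exists>y\<in>W. (x, y) \<in> E\<^sup>*)")
    case False
    then have "{C \<in> V // E'\<^sup>*. C \<subseteq> N} = {C \<in> V // E\<^sup>*. C \<subseteq> N}"
      using old new by blast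
    then show ?thesis using False by simp
  next
    case True
    then obtain d t where dt: "(d, t) \<in> E" "d \<in> U" "t \<notin> U" by blast
    let ?C = "E'\<^sup>* `` {t}"
    have uniq: "E'\<^sup>* `` {t'} = ?C" if "(d', t') \<in> E" "d' \<in> U" "t' \<notin> U" for d' t'
    proof -
      have "(t, t') \<in> E'" using cross_E'(2)[of d t d' t'] dt that by auto
      then show ?thesis using E'_class[of t t'] by blast
    qed
    have "?C \<in> V // E'\<^sup>*" using dt V(2) quotientI[of t V "E'\<^sup>*"] by blast
    moreover have "?C \<subseteq> N"
    proof
      fix y assume "y \<in> ?C"
      then have ty: "(t, y) \<in> E'\<^sup>*" by simp
      then have "(t, y) \<in> E\<^sup>*" using E'_sub by blast
      then have dy: "(d, y) \<in> E\<^sup>*" using dt(1) by (rule converse_rtrancl_into_rtrancl[rotated])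
      have "y \<in> V" using V_closed[OF dy] dt V(2) by auto
      moreover have "y \<notin> U" using E'_side[OF ty] dt by simp
      moreover have "y \<notin> W" using True dy dt by blast
      ultimately show "y \<in> N" using V(3) by blast
    qed
    ultimately have eq: "{C \<in> V // E'\<^sup>*. C \<subseteq> N} = insert ?C {C \<in> V // E\<^sup>*. C \<subseteq> N}"
      using old new uniq by blast
    \<comment> \<open>In the uncut graph the component of \<open>t\<close> also contains
      \<open>d \<in> U\<close>, which is outside \<open>N\<close>.\<close>
    have "?C \<notin> {C \<in> V // E\<^sup>*. C \<subseteq> N}"
    proof
      assume "?C \<in> {C \<in> V // E\<^sup>*. C \<subseteq> N}"
      then obtain x where x: "?C = E\<^sup>* `` {x}" "?C \<subseteq> N" by (auto simp: quotient_def)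
      then have "(x, t) \<in> E\<^sup>*" by auto
      moreover have "(t, d) \<in> E" using dt sym_E by (auto dest: symD)
      ultimately have "d \<in> ?C" using x rtrancl_into_rtrancl[of x t E d] by simp
      then show False using x(2) dt V(4) by blast
    qed
    then show ?thesis using True fin eq by simp
  qed
qed

end

section \<open>Splitting transversal blocks\<close>

definition transversals :: "vertex set set \<Rightarrow> vertex set set" where
  "transversals \<alpha> = {A \<in> \<alpha>. A \<inter> range Up \<noteq> {} \<and> A \<inter> range Low \<noteq> {}}"

definition split :: "vertex set set \<Rightarrow> vertex set set" where
  "split \<alpha> = (\<Union>A\<in>\<alpha>. {A \<inter> range Up, A \<inter> range Low}) - {{}}"

text \<open>The rank is the number of transversal blocks; these are the partitions of rank zero or
  one.\<close>

definition low_rank :: "nat \<Rightarrow> vertex set set set" where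
  "low_rank n = {\<alpha> \<in> partitions n. \<forall>A\<in>transversals \<alpha>. \<forall>B\<in>transversals \<alpha>. A = B}"

lemma partitionsD:
  assumes "\<alpha> \<in> partitions n"
  shows "\<And>A. A \<in> \<alpha> \<Longrightarrow> A \<subseteq> boundary n" "\<Union>\<alpha> = boundary n" "{} \<notin> \<alpha>"
    "\<And>A B. A \<in> \<alpha> \<Longrightarrow> B \<in> \<alpha> \<Longrightarrow> A \<inter> B \<noteq> {} \<Longrightarrow> A = B"
  using assms by (auto simp: partitions_def partition_on_def disjoint_def)

text \<open>Product graphs see a partition only through pairs of points in a common block, so
  splitting is recorded in that form.\<close>

lemma ex_split_iff:
  "(\<exists>B\<in>split \<alpha>. u \<in> B \<and> v \<in> B) \<longleftrightarrow> (\<exists>A\<in>\<alpha>. u \<in> A \<and> v \<in> A \<and>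
    (u \<in> range Up \<and> v \<in> range Up \<or> u \<in> range Low \<and> v \<in> range Low))"
proof -
  \<comment> \<open>Variables in place of \<open>range Up\<close> and \<open>range Low\<close> keep
    membership in these ranges opaque to the automation.\<close>
  have "(\<exists>B\<in>(\<Union>A\<in>\<alpha>. {A \<inter> U, A \<inter> L}) - {{}}. u \<in> B \<and> v \<in> B) \<longleftrightarrow>
      (\<exists>A\<in>\<alpha>. u \<in> A \<and> v \<in> A \<and> (u \<in> U \<and> v \<in> U \<or> u \<in> L \<and> v \<in> L))" for U L
    by auto
  then show ?thesis unfolding split_def .
qed

lemma range_Low_iff: "x \<in> boundary n \<Longrightarrow> x \<in> range Low \<longleftrightarrow> x \<notin> range Up"
  by (auto simp: boundary_def)

lemma boundary_sides: "boundary n \<subseteq> range Up \<union> range Low"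
  by (auto simp: boundary_def)

lemma split_in_partitions:
  assumes "\<alpha> \<in> partitions n"
  shows "split \<alpha> \<in> partitions n"
  unfolding partitions_def mem_Collect_eq
proof (rule partition_onI)
  show "\<Union>(split \<alpha>) = boundary n"
  proof (intro Set.set_eqI)
    fix x
    have "x \<in> \<Union>(split \<alpha>) \<longleftrightarrow> x \<in> \<Union>\<alpha> \<and> x \<in> range Up \<union> range Low"
      using ex_split_iff[of \<alpha> x x] by auto
    then show "x \<in> \<Union>(split \<alpha>) \<longleftrightarrow> x \<in> boundary n"
      using partitionsD(2)[OF assms] boundary_sides by auto
  qed
  show "disjnt A B" if "A \<in> split \<alpha>" "B \<in> split \<alpha>" "A \<noteq> B" for A B
  proof (rule ccontr)
    assume "\<not> disjnt A B"
    then obtain x where "x \<in> A" "x \<in> B" by (auto simp: disjnt_def)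
    with that show False
      using partitionsD(4)[OF assms] unfolding split_def by auto
  qed
qed (auto simp: split_def)

lemma transversals_split [simp]: "transversals (split \<alpha>) = {}"
  by (auto simp: transversals_def split_def)

lemma split_id:
  assumes "\<alpha> \<in> partitions n" "transversals \<alpha> = {}"
  shows "split \<alpha> = \<alpha>"
proof -
  have "{A \<inter> range Up, A \<inter> range Low} - {{}} = {A}" if "A \<in> \<alpha>" for A
  proof -
    have "A \<subseteq> range Up \<union> range Low" "A \<noteq> {}"
      using partitionsD(1,3)[OF assms(1)] that boundary_sides by blast+
    moreover have "A \<inter> range Up = {} \<or> A \<inter> range Low = {}"
      using assms(2) that by (auto simp: transversals_def)
    ultimately show ?thesis by blast
  qed
  then have "(\<Union>A\<in>\<alpha>. {A \<inter> range Up, A \<inter> range Low} - {{}}) = (\<Union>A\<in>\<alpha>. {A})"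
    by (rule SUP_cong[OF refl])
  then show ?thesis by (simp add: split_def)
qed

text \<open>Merging the block of \<open>Up 1\<close> with that of \<open>Low 1\<close>, which exist
  as \<open>n \<ge> 1\<close>, creates a single transversal block, and splitting undoes the
  merger.\<close>

lemma ex_split_preimage:
  assumes "n \<ge> 1" "\<beta> \<in> partitions n" "transversals \<beta> = {}"
  obtains \<alpha> where "\<alpha> \<in> low_rank n" "transversals \<alpha> \<noteq> {}" "split \<alpha> = \<beta>"
proof -
  have "Up 1 \<in> boundary n" "Low 1 \<in> boundary n" using assms(1) by (auto simp: boundary_def)
  then obtain A B where AB: "A \<in> \<beta>" "Up 1 \<in> A" "B \<in> \<beta>" "Low 1 \<in> B"
    using partitionsD(2)[OF assms(2)] by blast
  have nt: "C \<inter> range Up = {} \<or> C \<inter> range Low = {}" if "C \<in> \<beta>" for C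
    using assms(3) that by (auto simp: transversals_def)
  have sub: "C \<subseteq> range Up \<union> range Low" if "C \<in> \<beta>" for C
    using partitionsD(1)[OF assms(2) that] boundary_sides by blast
  have A: "A \<subseteq> range Up" and B: "B \<subseteq> range Low"
  proof -
    have "A \<inter> range Up \<noteq> {}" "B \<inter> range Low \<noteq> {}" using AB by auto
    then have "A \<inter> range Low = {}" "B \<inter> range Up = {}"
      using nt[OF AB(1)] nt[OF AB(3)] by simp_all
    then show "A \<subseteq> range Up" "B \<subseteq> range Low"
      using sub[OF AB(1)] sub[OF AB(3)] by auto
  qed
  have UL: "range Up \<inter> range Low = {}" by auto
  let ?\<alpha> = "insert (A \<union> B) (\<beta> - {A, B})"
  have tr: "transversals ?\<alpha> = {A \<union> B}"
    using nt AB by (auto simp: transversals_def)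
  have "?\<alpha> \<in> partitions n"
    unfolding partitions_def mem_Collect_eq
  proof (rule partition_onI)
    show "\<Union>?\<alpha> = boundary n" using partitionsD(2)[OF assms(2)] AB by blast
    show "disjnt C D" if "C \<in> ?\<alpha>" "D \<in> ?\<alpha>" "C \<noteq> D" for C D
      using that partitionsD(4)[OF assms(2)] AB unfolding disjnt_def by blast
    show "{} \<notin> ?\<alpha>" using partitionsD(3)[OF assms(2)] AB by blast
  qed
  then have 1: "?\<alpha> \<in> low_rank n" using tr by (simp add: low_rank_def)
  have "split ?\<alpha> = split ({A, B} \<union> (\<beta> - {A, B}))"
  proof -
    have "(A \<union> B) \<inter> range Up = A" "(A \<union> B) \<inter> range Low = B" "A \<inter> range Up = A"
      "A \<inter> range Low = {}" "B \<inter> range Up = {}" "B \<inter> range Low = B"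
      using A B UL by blast+
    then have "split (insert (A \<union> B) R) = split ({A, B} \<union> R)" for R
      unfolding split_def by (simp add: insert_Diff_if insert_commute)
    then show ?thesis .
  qed
  also have "{A, B} \<union> (\<beta> - {A, B}) = \<beta>" using AB by blast
  finally have "split ?\<alpha> = \<beta>" using split_id[OF assms(2,3)] by simp
  with 1 tr that show thesis by blast
qed

text \<open>Each nonempty half of a class is the class, under the relation restricted to equal
  sides, of any of its points.\<close>

lemma split_quotient:
  assumes "equiv (boundary n) r"
  shows "split (boundary n // r) =
    boundary n // {(x, y) \<in> r. x \<in> range Up \<longleftrightarrow> y \<in> range Up}" (is "_ = _ // ?r")
proof -
  have sub: "r \<subseteq> boundary n \<times> boundary n" using assms by (auto simp: equiv_def)
  have cls: "r `` {x} \<inter> range Up = ?r `` {x}" if "x \<in> range Up" for x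
    using that by auto
  have cls': "r `` {x} \<inter> range Low = ?r `` {x}" if "x \<in> range Low" for x
  proof (rule Set.set_eqI)
    fix y
    have "x \<notin> range Up" using that by auto
    then show "y \<in> r `` {x} \<inter> range Low \<longleftrightarrow> y \<in> ?r `` {x}"
      using sub range_Low_iff[of y n] by auto
  qed
  have rep: "r `` {x} = r `` {y}" if "y \<in> r `` {x}" for x y
    using that assms by (simp add: equiv_class_eq)
  have rr: "(x, x) \<in> r" if "x \<in> boundary n" for x
    using that assms by (auto simp: equiv_def refl_on_def)
  show ?thesis
  proof (intro Set.set_eqI iffI)
    fix C assume "C \<in> split (boundary n // r)"
    then obtain x where x: "x \<in> boundary n" "C \<noteq> {}"
      "C = r `` {x} \<inter> range Up \<or> C = r `` {x} \<inter> range Low"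
      by (auto simp: split_def quotient_def)
    then obtain y where y: "y \<in> C" by blast
    then have "r `` {x} = r `` {y}" using rep x by blast
    then have "C = ?r `` {y}" using x(3) y cls[of y] cls'[of y] by auto
    moreover have "y \<in> boundary n" using x y sub by auto
    ultimately show "C \<in> boundary n // ?r" using quotientI[of y "boundary n" ?r] by simp
  next
    fix C assume "C \<in> boundary n // ?r"
    then obtain x where x: "x \<in> boundary n" "C = ?r `` {x}" by (auto simp: quotient_def)
    then have "C = r `` {x} \<inter> range Up \<or> C = r `` {x} \<inter> range Low"
      using cls[of x] cls'[of x] range_Low_iff[of x n] by (cases "x \<in> range Up") simp_all
    moreover have "C \<noteq> {}" using x rr by auto
    ultimately show "C \<in> split (boundary n // r)"
      using x by (auto simp: split_def quotient_def)
  qed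
qed

section \<open>Products with a partition of rank at most one\<close>

lemma sym_product_edges: "sym (product_edges \<alpha> \<beta>)"
  by (auto simp: product_edges_def sym_def)

lemma product_edges_subset:
  assumes "\<alpha> \<in> partitions n" "\<beta> \<in> partitions n"
  shows "product_edges \<alpha> \<beta> \<subseteq> product_vertices n \<times> product_vertices n"
proof -
  have "low_to_mid v \<in> product_vertices n" "up_to_mid v \<in> product_vertices n"
    if "v \<in> boundary n" for v
    using that by (auto simp: boundary_def product_vertices_def)
  then show ?thesis
    using partitionsD(1)[OF assms(1)] partitionsD(1)[OF assms(2)]
    unfolding product_edges_def by blast
qed

lemma boundary_eq: "boundary n = product_vertices n \<inter> (range Up \<union> range Low)"
  by (auto simp: boundary_def product_vertices_def)

text \<open>The reflexive closure also relates each vertex outside the graph to itself. Since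
  \<open>x \<noteq> y\<close>, the path has at least one edge, and edges have their ends in
  \<open>product_vertices n\<close>.\<close>

lemma product_edges_rtrancl_boundary:
  assumes "\<alpha> \<in> partitions n" "\<beta> \<in> partitions n"
    and "(x, y) \<in> (product_edges \<alpha> \<beta>)\<^sup>*" "x \<noteq> y"
    and "x \<in> range Up \<union> range Low" "y \<in> range Up \<union> range Low"
  shows "x \<in> boundary n" "y \<in> boundary n"
proof -
  have "(x, y) \<in> (product_edges \<alpha> \<beta>)\<^sup>+" using assms by (simp add: rtrancl_eq_or_trancl)
  then have "(x, y) \<in> product_vertices n \<times> product_vertices n"
    using product_edges_subset[OF assms(1,2)] trancl_subset_Sigma by blast
  then show "x \<in> boundary n" "y \<in> boundary n" using assms by (auto simp: boundary_eq)
qed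

text \<open>This path criterion, phrased with the full ranges, matches the condition on
  \<open>U\<close> and \<open>W\<close> in \<open>card_components_cut\<close>.\<close>

lemma transversals_mult_iff:
  assumes "\<alpha> \<in> partitions n" "\<beta> \<in> partitions n"
  shows "transversals (partition_mult n \<alpha> \<beta>) \<noteq> {} \<longleftrightarrow>
    (\<exists>x\<in>range Up. \<exists>y\<in>range Low. (x, y) \<in> (product_edges \<alpha> \<beta>)\<^sup>*)" (is "?l \<longleftrightarrow> ?r")
proof
  assume ?l
  then obtain z x y where "(z, x) \<in> (product_edges \<alpha> \<beta>)\<^sup>*" "(z, y) \<in> (product_edges \<alpha> \<beta>)\<^sup>*"
    "x \<in> range Up" "y \<in> range Low"
    by (auto simp: transversals_def partition_mult_def quotient_def)
  then show ?r
    using equiv_rtrancl_product_edges[of \<alpha> \<beta>] by (meson equivE symD transD)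
next
  assume ?r
  then obtain x y where xy: "x \<in> range Up" "y \<in> range Low" "(x, y) \<in> (product_edges \<alpha> \<beta>)\<^sup>*"
    by blast
  then have "x \<noteq> y" by auto
  then have b: "x \<in> boundary n" "y \<in> boundary n"
    using product_edges_rtrancl_boundary[OF assms xy(3)] xy by auto
  let ?r = "{(x, y) \<in> boundary n \<times> boundary n. (x, y) \<in> (product_edges \<alpha> \<beta>)\<^sup>*}"
  have "?r `` {x} \<in> partition_mult n \<alpha> \<beta>"
    unfolding partition_mult_def by (rule quotientI) fact
  moreover have "x \<in> ?r `` {x}" "y \<in> ?r `` {x}"
    using xy b by auto
  ultimately show ?l using xy unfolding transversals_def by blast
qed

text \<open>Two transversal blocks of the product supply two paths from top to bottom; the
  hypothesis connects their upper ends, so the blocks coincide.\<close>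

lemma low_rank_mult:
  assumes "\<And>x x' y y'. (x, y) \<in> (product_edges \<alpha> \<beta>)\<^sup>* \<Longrightarrow> (x', y') \<in> (product_edges \<alpha> \<beta>)\<^sup>* \<Longrightarrow>
    x \<in> range Up \<Longrightarrow> x' \<in> range Up \<Longrightarrow> y \<in> range Low \<Longrightarrow> y' \<in> range Low \<Longrightarrow>
    (x, x') \<in> (product_edges \<alpha> \<beta>)\<^sup>*"
  shows "partition_mult n \<alpha> \<beta> \<in> low_rank n"
proof -
  let ?r = "{(x, y) \<in> boundary n \<times> boundary n. (x, y) \<in> (product_edges \<alpha> \<beta>)\<^sup>*}"
  have eq: "equiv (boundary n) ?r"
    using equiv_rtrancl_product_edges[of \<alpha> \<beta>]
    by (intro equivI) (auto simp: equiv_def refl_on_def sym_def intro!: transI)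
  have "C = D" if C: "C \<in> transversals (partition_mult n \<alpha> \<beta>)"
    and D: "D \<in> transversals (partition_mult n \<alpha> \<beta>)" for C D
  proof -
    have CD: "C \<in> boundary n // ?r" "D \<in> boundary n // ?r"
      using C D by (auto simp: transversals_def partition_mult_def)
    obtain x y x' y' where xy: "x \<in> C" "y \<in> C" "x \<in> range Up" "y \<in> range Low"
      "x' \<in> D" "y' \<in> D" "x' \<in> range Up" "y' \<in> range Low"
      using C D unfolding transversals_def by blast
    then have r: "(x, y) \<in> ?r" "(x', y') \<in> ?r"
      using CD quotient_eq_iff[OF eq CD(1) CD(1)] quotient_eq_iff[OF eq CD(2) CD(2)] by blast+
    then have "(x, x') \<in> ?r" using assms[of x y x' y'] xy by auto
    then show ?thesis using quotient_eq_iff[OF eq CD xy(1,5)] by blast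
  qed
  then show ?thesis by (auto simp: low_rank_def partition_mult_closed)
qed

lemma partition_mult_split:
  assumes "\<And>x y. x \<in> boundary n \<Longrightarrow> y \<in> boundary n \<Longrightarrow>
    (x, y) \<in> (product_edges \<alpha>' \<beta>')\<^sup>* \<longleftrightarrow>
    (x, y) \<in> (product_edges \<alpha> \<beta>)\<^sup>* \<and> (x \<in> range Up \<longleftrightarrow> y \<in> range Up)"
  shows "partition_mult n \<alpha>' \<beta>' = split (partition_mult n \<alpha> \<beta>)"
proof -
  let ?r = "{(x, y) \<in> boundary n \<times> boundary n. (x, y) \<in> (product_edges \<alpha> \<beta>)\<^sup>*}"
  have eq: "equiv (boundary n) ?r"
    using equiv_rtrancl_product_edges[of \<alpha> \<beta>]
    by (intro equivI) (auto simp: equiv_def refl_on_def sym_def intro!: transI)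
  have "{(x, y) \<in> boundary n \<times> boundary n. (x, y) \<in> (product_edges \<alpha>' \<beta>')\<^sup>*} =
      {(x, y) \<in> ?r. x \<in> range Up \<longleftrightarrow> y \<in> range Up}"
    using assms by auto
  then show ?thesis
    using split_quotient[OF eq] by (simp add: partition_mult_def)
qed

section \<open>Splitting a factor as cutting the product graph\<close>

lemma same_side_edges:
  assumes "\<And>v. g v \<notin> U" "\<And>v. f v \<in> U \<longleftrightarrow> v \<in> U"
  shows "{(f u, f v) | u v. P u v \<and> (u \<in> U \<longleftrightarrow> v \<in> U)} \<union> {(g u, g v) | u v. Q u v} =
    {(x, y) \<in> {(f u, f v) | u v. P u v} \<union> {(g u, g v) | u v. Q u v}. x \<in> U \<longleftrightarrow> y \<in> U}"
  using assms by auto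

text \<open>Edges from \<open>\<beta>\<close> join images under \<open>up_to_mid\<close> and never
  touch \<open>range Up\<close>, while \<open>low_to_mid\<close> preserves membership in
  \<open>range Up\<close>. Thus cutting the blocks of \<open>\<alpha>\<close> removes exactly the
  edges that leave the top row.\<close>

lemma product_edges_split_left:
  assumes "\<alpha> \<in> partitions n"
  shows "product_edges (split \<alpha>) \<beta> =
    {(x, y) \<in> product_edges \<alpha> \<beta>. x \<in> range Up \<longleftrightarrow> y \<in> range Up}"
proof -
  have up: "up_to_mid v \<notin> range Up" for v by (cases v) auto
  have side: "low_to_mid v \<in> range Up \<longleftrightarrow> v \<in> range Up" for v by (cases v) auto
  have blocks: "(\<exists>A\<in>split \<alpha>. u \<in> A \<and> v \<in> A) \<longleftrightarrow>
      (\<exists>A\<in>\<alpha>. u \<in> A \<and> v \<in> A) \<and> (u \<in> range Up \<longleftrightarrow> v \<in> range Up)" for u v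
  proof -
    have "u \<in> range Up \<and> v \<in> range Up \<or> u \<in> range Low \<and> v \<in> range Low \<longleftrightarrow>
        (u \<in> range Up \<longleftrightarrow> v \<in> range Up)" if "A \<in> \<alpha>" "u \<in> A" "v \<in> A" for A
    proof -
      have "u \<in> boundary n" "v \<in> boundary n"
        using partitionsD(1)[OF assms that(1)] that by auto
      then have "u \<in> range Low \<longleftrightarrow> u \<notin> range Up" "v \<in> range Low \<longleftrightarrow> v \<notin> range Up"
        by (simp_all only: range_Low_iff)
      then show ?thesis by satx
    qed
    then show ?thesis unfolding ex_split_iff by metis
  qed
  have edges: "product_edges \<gamma> \<beta> =
      {(low_to_mid u, low_to_mid v) | u v. \<exists>A\<in>\<gamma>. u \<in> A \<and> v \<in> A} \<union>
      {(up_to_mid u, up_to_mid v) | u v. \<exists>B\<in>\<beta>. u \<in> B \<and> v \<in> B}" for \<gamma>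
    by (auto simp: product_edges_def)
  show ?thesis unfolding edges blocks by (rule same_side_edges[OF up side])
qed

lemma product_edges_split_right:
  assumes "\<beta> \<in> partitions n"
  shows "product_edges \<alpha> (split \<beta>) =
    {(x, y) \<in> product_edges \<alpha> \<beta>. x \<in> range Low \<longleftrightarrow> y \<in> range Low}"
proof -
  have up: "low_to_mid v \<notin> range Low" for v by (cases v) auto
  have side: "up_to_mid v \<in> range Low \<longleftrightarrow> v \<in> range Low" for v by (cases v) auto
  have blocks: "(\<exists>A\<in>split \<beta>. u \<in> A \<and> v \<in> A) \<longleftrightarrow>
      (\<exists>A\<in>\<beta>. u \<in> A \<and> v \<in> A) \<and> (u \<in> range Low \<longleftrightarrow> v \<in> range Low)" for u v
  proof -
    have "u \<in> range Up \<and> v \<in> range Up \<or> u \<in> range Low \<and> v \<in> range Low \<longleftrightarrow>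
        (u \<in> range Low \<longleftrightarrow> v \<in> range Low)" if "A \<in> \<beta>" "u \<in> A" "v \<in> A" for A
    proof -
      have "u \<in> boundary n" "v \<in> boundary n"
        using partitionsD(1)[OF assms that(1)] that by auto
      then have "u \<in> range Low \<longleftrightarrow> u \<notin> range Up" "v \<in> range Low \<longleftrightarrow> v \<notin> range Up"
        by (simp_all only: range_Low_iff)
      then show ?thesis by satx
    qed
    then show ?thesis unfolding ex_split_iff by metis
  qed
  have edges: "product_edges \<alpha> \<gamma> =
      {(up_to_mid u, up_to_mid v) | u v. \<exists>B\<in>\<gamma>. u \<in> B \<and> v \<in> B} \<union>
      {(low_to_mid u, low_to_mid v) | u v. \<exists>A\<in>\<alpha>. u \<in> A \<and> v \<in> A}" for \<gamma>
    by (auto simp: product_edges_def)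
  show ?thesis unfolding edges blocks by (rule same_side_edges[OF up side])
qed

text \<open>Only \<open>\<alpha>\<close> contributes edges at the top row, so a crossing edge comes
  from a block of \<open>\<alpha>\<close> that meets both rows.\<close>

lemma crossing_edge_left:
  assumes "\<alpha> \<in> partitions n"
  shows "(x, y) \<in> product_edges \<alpha> \<beta> \<and> x \<in> range Up \<and> y \<notin> range Up \<longleftrightarrow>
    (\<exists>A\<in>transversals \<alpha>. x \<in> low_to_mid ` (A \<inter> range Up) \<and> y \<in> low_to_mid ` (A \<inter> range Low))"
    (is "?l \<longleftrightarrow> ?r")
proof
  assume l: ?l
  have "up_to_mid v \<notin> range Up" for v by (cases v) auto
  then have "x \<notin> up_to_mid ` B" for B using l by blast
  then obtain A u v where A: "A \<in> \<alpha>" "u \<in> A" "v \<in> A" "x = low_to_mid u" "y = low_to_mid v"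
    using l unfolding product_edges_def by blast
  have "u \<in> range Up" using A l by (cases u) auto
  moreover have "v \<in> range Low"
    using A l partitionsD(1)[OF assms A(1)] boundary_sides by (cases v) auto
  ultimately show ?r using A by (auto simp: transversals_def intro!: bexI[of _ A])
qed (auto simp: transversals_def product_edges_def intro!: bexI)

lemma crossing_edge_right:
  assumes "\<beta> \<in> partitions n"
  shows "(x, y) \<in> product_edges \<alpha> \<beta> \<and> x \<in> range Low \<and> y \<notin> range Low \<longleftrightarrow>
    (\<exists>A\<in>transversals \<beta>. x \<in> up_to_mid ` (A \<inter> range Low) \<and> y \<in> up_to_mid ` (A \<inter> range Up))"
    (is "?l \<longleftrightarrow> ?r")
proof
  assume l: ?l
  have "low_to_mid v \<notin> range Low" for v by (cases v) auto
  then have "x \<notin> low_to_mid ` B" for B using l by blast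
  then obtain A u v where A: "A \<in> \<beta>" "u \<in> A" "v \<in> A" "x = up_to_mid u" "y = up_to_mid v"
    using l unfolding product_edges_def by blast
  have "u \<in> range Low" using A l by (cases u) auto
  moreover have "v \<in> range Up"
    using A l partitionsD(1)[OF assms A(1)] boundary_sides by (cases v) auto
  ultimately show ?r using A by (auto simp: transversals_def intro!: bexI[of _ A])
qed (auto simp: transversals_def product_edges_def intro!: bexI)

text \<open>Crossing edges come from transversal blocks of \<open>\<alpha>\<close>. In rank at most
  one this is always the same block, and any two of its vertices are adjacent.\<close>

lemma cut_graph_left:
  assumes "\<alpha> \<in> low_rank n"
  shows "cut_graph (product_edges \<alpha> \<beta>) (range Up)"
proof
  have \<alpha>: "\<alpha> \<in> partitions n" using assms by (simp add: low_rank_def)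
  fix x y x' y'
  assume "(x, y) \<in> product_edges \<alpha> \<beta>" "(x', y') \<in> product_edges \<alpha> \<beta>"
    "x \<in> range Up" "x' \<in> range Up" "y \<notin> range Up" "y' \<notin> range Up"
  then obtain A B where AB: "A \<in> transversals \<alpha>" "B \<in> transversals \<alpha>"
    and xy: "x \<in> low_to_mid ` A" "y \<in> low_to_mid ` A" "x' \<in> low_to_mid ` B" "y' \<in> low_to_mid ` B"
    using crossing_edge_left[OF \<alpha>, of x y \<beta>] crossing_edge_left[OF \<alpha>, of x' y' \<beta>] by blast
  have "A = B" using AB assms unfolding low_rank_def by blast
  moreover have "A \<in> \<alpha>" using AB(1) unfolding transversals_def by blast
  ultimately show "(x, x') \<in> product_edges \<alpha> \<beta> \<and> (y, y') \<in> product_edges \<alpha> \<beta>"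
    using xy unfolding product_edges_def by blast
qed (rule sym_product_edges)

lemma cut_graph_right:
  assumes "\<beta> \<in> low_rank n"
  shows "cut_graph (product_edges \<alpha> \<beta>) (range Low)"
proof
  have \<beta>: "\<beta> \<in> partitions n" using assms by (simp add: low_rank_def)
  fix x y x' y'
  assume "(x, y) \<in> product_edges \<alpha> \<beta>" "(x', y') \<in> product_edges \<alpha> \<beta>"
    "x \<in> range Low" "x' \<in> range Low" "y \<notin> range Low" "y' \<notin> range Low"
  then obtain A B where AB: "A \<in> transversals \<beta>" "B \<in> transversals \<beta>"
    and xy: "x \<in> up_to_mid ` A" "y \<in> up_to_mid ` A" "x' \<in> up_to_mid ` B" "y' \<in> up_to_mid ` B"
    using crossing_edge_right[OF \<beta>, of x y \<alpha>] crossing_edge_right[OF \<beta>, of x' y' \<alpha>] by blast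
  have "A = B" using AB assms unfolding low_rank_def by blast
  moreover have "A \<in> \<beta>" using AB(1) unfolding transversals_def by blast
  ultimately show "(x, x') \<in> product_edges \<alpha> \<beta> \<and> (y, y') \<in> product_edges \<alpha> \<beta>"
    using xy unfolding product_edges_def by blast
qed (rule sym_product_edges)

text \<open>This turns the first condition in \<open>card_components_cut\<close> into one on the
  rank of \<open>\<alpha>\<close>.\<close>

lemma ex_crossing_edge_left:
  assumes "\<alpha> \<in> partitions n"
  shows "(\<exists>d\<in>range Up. \<exists>t. t \<notin> range Up \<and> (d, t) \<in> product_edges \<alpha> \<beta>) \<longleftrightarrow> transversals \<alpha> \<noteq> {}"
proof -
  have "(\<exists>d t. \<exists>A\<in>transversals \<alpha>. d \<in> low_to_mid ` (A \<inter> range Up) \<and> t \<in> low_to_mid ` (A \<inter> range Low))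
      \<longleftrightarrow> transversals \<alpha> \<noteq> {}"
    unfolding transversals_def by fast
  then show ?thesis unfolding crossing_edge_left[OF assms, of _ _ \<beta>, symmetric] by auto
qed

lemma ex_crossing_edge_right:
  assumes "\<beta> \<in> partitions n"
  shows "(\<exists>d\<in>range Low. \<exists>t. t \<notin> range Low \<and> (d, t) \<in> product_edges \<alpha> \<beta>) \<longleftrightarrow> transversals \<beta> \<noteq> {}"
proof -
  have "(\<exists>d t. \<exists>A\<in>transversals \<beta>. d \<in> up_to_mid ` (A \<inter> range Low) \<and> t \<in> up_to_mid ` (A \<inter> range Up))
      \<longleftrightarrow> transversals \<beta> \<noteq> {}"
    unfolding transversals_def by fast
  then show ?thesis unfolding crossing_edge_right[OF assms, of _ _ \<alpha>, symmetric] by auto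
qed

lemma finite_product_vertices: "finite (product_vertices n)"
  by (simp add: product_vertices_def)

lemma rtrancl_product_edges_sym:
  "(x, y) \<in> (product_edges \<alpha> \<beta>)\<^sup>* \<longleftrightarrow> (y, x) \<in> (product_edges \<alpha> \<beta>)\<^sup>*"
  using equiv_rtrancl_product_edges[of \<alpha> \<beta>] by (meson equivE symD)

text \<open>Everything follows from cutting off the top row. \<open>Phi\<close> grows by 1 under
  splitting exactly when \<open>\<alpha>\<close> has a transversal block and the product has none:
  then the lower half of that block lies in a new floating component. The indicators are placed
  additively so that the last equation becomes the first coordinate of
  \<open>split_elem_mult\<close>.\<close>

lemma mult_low_rank_left:
  assumes "\<alpha> \<in> low_rank n" "\<gamma> \<in> partitions n"
  shows "partition_mult n \<alpha> \<gamma> \<in> low_rank n"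
    and "partition_mult n (split \<alpha>) \<gamma> = split (partition_mult n \<alpha> \<gamma>)"
    and "transversals \<alpha> = {} \<Longrightarrow> transversals (partition_mult n \<alpha> \<gamma>) = {}"
    and "Phi n (split \<alpha>) \<gamma> + (if transversals \<alpha> = {} then 1 else 0) =
      Phi n \<alpha> \<gamma> + (if transversals (partition_mult n \<alpha> \<gamma>) = {} then 1 else 0)"
proof -
  have \<alpha>: "\<alpha> \<in> partitions n" using assms by (simp add: low_rank_def)
  interpret cut_graph "product_edges \<alpha> \<gamma>" "range Up"
    by (rule cut_graph_left[OF assms(1)])
  have E': "E' = product_edges (split \<alpha>) \<gamma>"
    by (simp add: E'_def product_edges_split_left[OF \<alpha>])
  show "partition_mult n \<alpha> \<gamma> \<in> low_rank n"
    by (rule low_rank_mult) (rule crossing_paths_connected, auto)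
  show "partition_mult n (split \<alpha>) \<gamma> = split (partition_mult n \<alpha> \<gamma>)"
    by (rule partition_mult_split) (auto simp: E'_rtrancl simp flip: E')
  have tr: "transversals \<alpha> \<noteq> {}" if "transversals (partition_mult n \<alpha> \<gamma>) \<noteq> {}"
  proof -
    obtain x y where "x \<in> range Up" "y \<in> range Low" "(x, y) \<in> (product_edges \<alpha> \<gamma>)\<^sup>*"
      using \<open>transversals (partition_mult n \<alpha> \<gamma>) \<noteq> {}\<close> transversals_mult_iff[OF \<alpha> assms(2)]
      by blast
    moreover from this have "y \<notin> range Up" by auto
    ultimately obtain d t where "(d, t) \<in> product_edges \<alpha> \<gamma>" "d \<in> range Up" "t \<notin> range Up"
      using crossing_path by metis
    then show ?thesis using ex_crossing_edge_left[OF \<alpha>] by blast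
  qed
  then show "transversals \<alpha> = {} \<Longrightarrow> transversals (partition_mult n \<alpha> \<gamma>) = {}" by blast
  \<comment> \<open>Here \<open>U\<close> is the top row, \<open>N\<close> the middle row and
    \<open>W\<close> the bottom row.\<close>
  have "Phi n (split \<alpha>) \<gamma> = Phi n \<alpha> \<gamma> +
      (if transversals \<alpha> \<noteq> {} \<and> \<not> transversals (partition_mult n \<alpha> \<gamma>) \<noteq> {} then 1 else 0)"
    unfolding Phi_def product_components_def transversals_mult_iff[OF \<alpha> assms(2)]
      ex_crossing_edge_left[OF \<alpha>, of \<gamma>, symmetric] E'[symmetric]
    by (rule card_components_cut)
      (use finite_product_vertices product_edges_subset[OF \<alpha> assms(2)] in
        \<open>auto simp: product_vertices_def\<close>)
  then show "Phi n (split \<alpha>) \<gamma> + (if transversals \<alpha> = {} then 1 else 0) =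
      Phi n \<alpha> \<gamma> + (if transversals (partition_mult n \<alpha> \<gamma>) = {} then 1 else 0)"
    using tr by auto
qed

text \<open>The mirror image of \<open>mult_low_rank_left\<close>, cutting off the bottom row:
  \<open>U\<close> is now \<open>range Low\<close> and \<open>W\<close> is \<open>range Up\<close>,
  so paths are read from bottom to top.\<close>

lemma mult_low_rank_right:
  assumes "\<alpha> \<in> low_rank n" "\<gamma> \<in> partitions n"
  shows "partition_mult n \<gamma> \<alpha> \<in> low_rank n"
    and "partition_mult n \<gamma> (split \<alpha>) = split (partition_mult n \<gamma> \<alpha>)"
    and "transversals \<alpha> = {} \<Longrightarrow> transversals (partition_mult n \<gamma> \<alpha>) = {}"
    and "Phi n \<gamma> (split \<alpha>) + (if transversals \<alpha> = {} then 1 else 0) =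
      Phi n \<gamma> \<alpha> + (if transversals (partition_mult n \<gamma> \<alpha>) = {} then 1 else 0)"
proof -
  have \<alpha>: "\<alpha> \<in> partitions n" using assms by (simp add: low_rank_def)
  interpret cut_graph "product_edges \<gamma> \<alpha>" "range Low"
    by (rule cut_graph_right[OF assms(1)])
  have E': "E' = product_edges \<gamma> (split \<alpha>)"
    by (simp add: E'_def product_edges_split_right[OF \<alpha>])
  have tr_iff: "transversals (partition_mult n \<gamma> \<alpha>) \<noteq> {} \<longleftrightarrow>
      (\<exists>x\<in>range Low. \<exists>y\<in>range Up. (x, y) \<in> (product_edges \<gamma> \<alpha>)\<^sup>*)"
    using transversals_mult_iff[OF assms(2) \<alpha>] rtrancl_product_edges_sym[of _ _ \<gamma> \<alpha>] by blast
  show "partition_mult n \<gamma> \<alpha> \<in> low_rank n"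
  proof (rule low_rank_mult)
    fix x x' y y'
    assume xy: "(x, y) \<in> (product_edges \<gamma> \<alpha>)\<^sup>*" "(x', y') \<in> (product_edges \<gamma> \<alpha>)\<^sup>*"
      "x \<in> range Up" "x' \<in> range Up" "y \<in> range Low" "y' \<in> range Low"
    \<comment> \<open>The cut graph connects the lower ends \<open>y\<close> and \<open>y'\<close>;
      the upper ends are then connected along the two given paths.\<close>
    then have "(y, y') \<in> (product_edges \<gamma> \<alpha>)\<^sup>*"
      by (intro crossing_paths_connected[of y x y' x'])
        (auto simp: rtrancl_product_edges_sym[of _ _ \<gamma> \<alpha>] intro: sym_E_rtrancl)
    then show "(x, x') \<in> (product_edges \<gamma> \<alpha>)\<^sup>*"
      using xy(1,2) by (meson rtrancl_trans sym_E_rtrancl)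
  qed
  show "partition_mult n \<gamma> (split \<alpha>) = split (partition_mult n \<gamma> \<alpha>)"
  proof (rule partition_mult_split)
    fix x y assume "x \<in> boundary n" "y \<in> boundary n"
    \<comment> \<open>The cut is phrased with the bottom row and \<open>partition_mult_split\<close>
      with the top row; on the boundary, lying on the same side means the same for both.\<close>
    then have "x \<in> range Low \<longleftrightarrow> x \<notin> range Up" "y \<in> range Low \<longleftrightarrow> y \<notin> range Up"
      by (auto simp: boundary_def)
    then show "(x, y) \<in> (product_edges \<gamma> (split \<alpha>))\<^sup>* \<longleftrightarrow>
        (x, y) \<in> (product_edges \<gamma> \<alpha>)\<^sup>* \<and> (x \<in> range Up \<longleftrightarrow> y \<in> range Up)"
      unfolding E'[symmetric] E'_rtrancl by blast
  qed
  have tr: "transversals \<alpha> \<noteq> {}" if "transversals (partition_mult n \<gamma> \<alpha>) \<noteq> {}"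
  proof -
    obtain x y where "x \<in> range Low" "y \<in> range Up" "(x, y) \<in> (product_edges \<gamma> \<alpha>)\<^sup>*"
      using \<open>transversals (partition_mult n \<gamma> \<alpha>) \<noteq> {}\<close> tr_iff by blast
    moreover from this have "y \<notin> range Low" by auto
    ultimately obtain d t where "(d, t) \<in> product_edges \<gamma> \<alpha>" "d \<in> range Low" "t \<notin> range Low"
      using crossing_path by metis
    then show ?thesis using ex_crossing_edge_right[OF \<alpha>] by blast
  qed
  then show "transversals \<alpha> = {} \<Longrightarrow> transversals (partition_mult n \<gamma> \<alpha>) = {}" by blast
  have "Phi n \<gamma> (split \<alpha>) = Phi n \<gamma> \<alpha> +
      (if transversals \<alpha> \<noteq> {} \<and> \<not> transversals (partition_mult n \<gamma> \<alpha>) \<noteq> {} then 1 else 0)"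
    unfolding Phi_def product_components_def tr_iff
      ex_crossing_edge_right[OF \<alpha>, of \<gamma>, symmetric] E'[symmetric]
    by (rule card_components_cut)
      (use finite_product_vertices product_edges_subset[OF assms(2) \<alpha>] in
        \<open>auto simp: product_vertices_def\<close>)
  then show "Phi n \<gamma> (split \<alpha>) + (if transversals \<alpha> = {} then 1 else 0) =
      Phi n \<gamma> \<alpha> + (if transversals (partition_mult n \<gamma> \<alpha>) = {} then 1 else 0)"
    using tr by auto
qed

section \<open>Congruences of the twisted partition monoid\<close>

definition split_elem :: "nat \<times> vertex set set \<Rightarrow> nat \<times> vertex set set" where
  "split_elem x = (fst x + (if transversals (snd x) = {} then 1 else 0), split (snd x))"

definition level :: "nat \<times> vertex set set \<Rightarrow> nat" where
  "level x = fst (split_elem x)"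

definition low_ideal :: "nat \<Rightarrow> nat \<Rightarrow> (nat \<times> vertex set set) set" where
  "low_ideal n k = {x \<in> UNIV \<times> low_rank n. k \<le> level x}"

text \<open>These elements form X, and \<open>rank_zero_layer\<close> is Y. As \<open>level\<close>
  adds 1 to the first coordinate only in rank zero, level 1 means first coordinate 1 in X and first
  coordinate 0 in Y.\<close>

definition rank_one_layer :: "nat \<Rightarrow> (nat \<times> vertex set set) set" where
  "rank_one_layer n = {x \<in> UNIV \<times> low_rank n. level x = 1 \<and> transversals (snd x) \<noteq> {}}"

definition rank_zero_layer :: "nat \<Rightarrow> (nat \<times> vertex set set) set" where
  "rank_zero_layer n = {x \<in> UNIV \<times> low_rank n. level x = 1 \<and> transversals (snd x) = {}}"

lemmas layer_defs = low_ideal_def rank_one_layer_def rank_zero_layer_def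

lemma low_rank_partitions: "\<alpha> \<in> low_rank n \<Longrightarrow> \<alpha> \<in> partitions n"
  by (simp add: low_rank_def)

lemma split_in_low_rank: "\<alpha> \<in> partitions n \<Longrightarrow> split \<alpha> \<in> low_rank n"
  by (simp add: low_rank_def split_in_partitions)

lemma carrier_twisted [simp]: "carrier (twisted_partition_monoid n) = UNIV \<times> partitions n"
  by (simp add: twisted_partition_monoid_def)

lemma mult_twisted:
  "x \<otimes>\<^bsub>twisted_partition_monoid n\<^esub> y =
    (fst x + fst y + Phi n (snd x) (snd y), partition_mult n (snd x) (snd y))"
  by (simp add: twisted_partition_monoid_def case_prod_beta)

interpretation twisted: magma "twisted_partition_monoid n" for n
  by standard (auto simp: mult_twisted partition_mult_closed)

text \<open>The second coordinates agree because splitting commutes with these products; in the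
  first, the summand 1 for rank zero absorbs the change of \<open>Phi\<close>.\<close>

lemma split_elem_mult:
  assumes "x \<in> UNIV \<times> low_rank n" "s \<in> UNIV \<times> partitions n"
  shows "split_elem (x \<otimes>\<^bsub>twisted_partition_monoid n\<^esub> s) =
      split_elem x \<otimes>\<^bsub>twisted_partition_monoid n\<^esub> s"
    and "split_elem (s \<otimes>\<^bsub>twisted_partition_monoid n\<^esub> x) =
      s \<otimes>\<^bsub>twisted_partition_monoid n\<^esub> split_elem x"
proof -
  have xs: "snd x \<in> low_rank n" "snd s \<in> partitions n" using assms by auto
  show "split_elem (x \<otimes>\<^bsub>twisted_partition_monoid n\<^esub> s) =
      split_elem x \<otimes>\<^bsub>twisted_partition_monoid n\<^esub> s"
    using mult_low_rank_left(2,4)[OF xs] by (simp add: mult_twisted split_elem_def)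
  show "split_elem (s \<otimes>\<^bsub>twisted_partition_monoid n\<^esub> x) =
      s \<otimes>\<^bsub>twisted_partition_monoid n\<^esub> split_elem x"
    using mult_low_rank_right(2,4)[OF xs] by (simp add: mult_twisted split_elem_def)
qed

text \<open>The level is the first coordinate of \<open>split_elem\<close>, which commutes with
  translations, and translations never lower a first coordinate. A fall from rank one to rank zero
  gains the extra 1 of \<open>split_elem\<close>, hence the strict inequality.\<close>

lemma translate_low_rank:
  assumes "x \<in> UNIV \<times> low_rank n" "s \<in> UNIV \<times> partitions n"
    and "y = x \<otimes>\<^bsub>twisted_partition_monoid n\<^esub> s \<or> y = s \<otimes>\<^bsub>twisted_partition_monoid n\<^esub> x"
  shows "y \<in> UNIV \<times> low_rank n" "level x \<le> level y"
    and "transversals (snd x) = {} \<Longrightarrow> transversals (snd y) = {}"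
    and "transversals (snd x) \<noteq> {} \<Longrightarrow> transversals (snd y) = {} \<Longrightarrow> level x < level y"
proof -
  have xs: "snd x \<in> low_rank n" "snd s \<in> partitions n" using assms by auto
  show "y \<in> UNIV \<times> low_rank n"
    using assms(3) mult_low_rank_left(1)[OF xs] mult_low_rank_right(1)[OF xs]
    by (auto simp: mult_twisted)
  show "level x \<le> level y"
    using assms(3) split_elem_mult[OF assms(1,2)] by (auto simp: level_def mult_twisted)
  show "transversals (snd x) = {} \<Longrightarrow> transversals (snd y) = {}"
    using assms(3) mult_low_rank_left(3)[OF xs] mult_low_rank_right(3)[OF xs]
    by (auto simp: mult_twisted)
  show "transversals (snd x) \<noteq> {} \<Longrightarrow> transversals (snd y) = {} \<Longrightarrow> level x < level y"
    using assms(3) by (auto simp: level_def split_elem_def mult_twisted)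
qed

lemma translate_low_ideal:
  assumes "x \<in> low_ideal n k" "s \<in> UNIV \<times> partitions n"
    and "y = x \<otimes>\<^bsub>twisted_partition_monoid n\<^esub> s \<or> y = s \<otimes>\<^bsub>twisted_partition_monoid n\<^esub> x"
  shows "y \<in> low_ideal n k"
proof -
  have x: "x \<in> UNIV \<times> low_rank n" "k \<le> level x" using assms(1) by (simp_all add: low_ideal_def)
  show ?thesis
    using translate_low_rank(1,2)[OF x(1) assms(2,3)] x(2) by (simp add: low_ideal_def)
qed

text \<open>Losing the transversal block raises the level to at least 2, so no translation leads
  from this layer into \<open>rank_zero_layer\<close>. This is what makes the two layers
  parallel.\<close>

lemma translate_rank_one_layer:
  assumes "x \<in> rank_one_layer n" "s \<in> UNIV \<times> partitions n"
    and "y = x \<otimes>\<^bsub>twisted_partition_monoid n\<^esub> s \<or> y = s \<otimes>\<^bsub>twisted_partition_monoid n\<^esub> x"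
  shows "y \<in> rank_one_layer n \<union> low_ideal n 2"
proof -
  have x: "x \<in> UNIV \<times> low_rank n" "level x = 1" "transversals (snd x) \<noteq> {}"
    using assms(1) by (simp_all add: rank_one_layer_def)
  show ?thesis
    using translate_low_rank(1,2,4)[OF x(1) assms(2,3)] x(2,3)
    by (cases "transversals (snd y) = {}"; cases "level y = 1") (simp_all add: layer_defs)
qed

lemma translate_rank_zero_layer:
  assumes "x \<in> rank_zero_layer n" "s \<in> UNIV \<times> partitions n"
    and "y = x \<otimes>\<^bsub>twisted_partition_monoid n\<^esub> s \<or> y = s \<otimes>\<^bsub>twisted_partition_monoid n\<^esub> x"
  shows "y \<in> rank_zero_layer n \<union> low_ideal n 2"
proof -
  have x: "x \<in> UNIV \<times> low_rank n" "level x = 1" "transversals (snd x) = {}"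
    using assms(1) by (simp_all add: rank_zero_layer_def)
  show ?thesis
    using translate_low_rank(1-3)[OF x(1) assms(2,3)] x(2,3)
    by (cases "level y = 1") (simp_all add: layer_defs)
qed

lemma split_elem_translate_eq:
  assumes "x \<in> UNIV \<times> low_rank n" "y \<in> UNIV \<times> low_rank n" "split_elem x = split_elem y"
    and "s \<in> UNIV \<times> partitions n"
  shows "split_elem (x \<otimes>\<^bsub>twisted_partition_monoid n\<^esub> s) =
      split_elem (y \<otimes>\<^bsub>twisted_partition_monoid n\<^esub> s) \<and>
    split_elem (s \<otimes>\<^bsub>twisted_partition_monoid n\<^esub> x) =
      split_elem (s \<otimes>\<^bsub>twisted_partition_monoid n\<^esub> y)"
  using split_elem_mult[OF assms(1,4)] split_elem_mult[OF assms(2,4)] assms(3) by simp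

lemma boundary_low_rank:
  assumes "n \<ge> 1"
  shows "{boundary n} \<in> low_rank n" "transversals {boundary n} \<noteq> {}"
proof -
  have "Up 1 \<in> boundary n" "Low 1 \<in> boundary n" using assms by (auto simp: boundary_def)
  then show "{boundary n} \<in> low_rank n" "transversals {boundary n} \<noteq> {}"
    by (auto simp: low_rank_def partitions_def transversals_def partition_on_def)
qed

lemma split_split: "\<alpha> \<in> partitions n \<Longrightarrow> split (split \<alpha>) = split \<alpha>"
  using split_id[OF split_in_partitions] by simp

lemma rank_zero_partner:
  assumes "x \<in> rank_one_layer n"
  shows "(0, split (snd x)) \<in> rank_zero_layer n" "split_elem (0, split (snd x)) = split_elem x"
proof -
  have x: "snd x \<in> low_rank n" "level x = 1" "transversals (snd x) \<noteq> {}"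
    using assms by (auto simp: rank_one_layer_def)
  then have p: "snd x \<in> partitions n" using low_rank_partitions by blast
  show "(0, split (snd x)) \<in> rank_zero_layer n"
    using p by (simp add: rank_zero_layer_def level_def split_elem_def split_in_low_rank)
  show "split_elem (0, split (snd x)) = split_elem x"
    using x p by (simp add: split_elem_def level_def split_split)
qed

text \<open>With \<open>rank_zero_partner\<close>, this gives \<open>split_elem\<close> the same
  image on both layers, so gluing along it connects every element of either layer to the other
  layer.\<close>

lemma rank_one_partner:
  assumes "n \<ge> 1" "y \<in> rank_zero_layer n"
  obtains x where "x \<in> rank_one_layer n" "split_elem x = split_elem y"
proof -
  have y: "snd y \<in> partitions n" "level y = 1" "transversals (snd y) = {}"
    using assms(2) by (auto simp: rank_zero_layer_def low_rank_partitions)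
  obtain \<alpha> where \<alpha>: "\<alpha> \<in> low_rank n" "transversals \<alpha> \<noteq> {}" "split \<alpha> = snd y"
    using ex_split_preimage[OF assms(1) y(1,3)] .
  then have "(1, \<alpha>) \<in> rank_one_layer n"
    by (simp add: rank_one_layer_def level_def split_elem_def)
  moreover have "split_elem (1, \<alpha>) = split_elem y"
    using \<alpha> y split_id[OF y(1,3)] by (simp add: split_elem_def level_def)
  ultimately show thesis using that by blast
qed

text \<open>Splitting fixes partitions of rank zero, and the added 1 is common to both
  elements.\<close>

lemma split_elem_inj_rank_zero:
  assumes "x \<in> rank_zero_layer n" "y \<in> rank_zero_layer n" "split_elem x = split_elem y"
  shows "x = y"
proof -
  have "snd x \<in> partitions n" "transversals (snd x) = {}"
    "snd y \<in> partitions n" "transversals (snd y) = {}"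
    using assms by (auto simp: rank_zero_layer_def low_rank_partitions)
  then show ?thesis
    using assms(3) split_id by (simp add: split_elem_def prod_eq_iff)
qed

lemma layer_subset:
  "low_ideal n k \<subseteq> UNIV \<times> partitions n" "rank_one_layer n \<subseteq> UNIV \<times> partitions n"
  "rank_zero_layer n \<subseteq> UNIV \<times> partitions n"
  by (auto simp: layer_defs low_rank_partitions)

lemma layer_disjoint:
  "low_ideal n 2 \<inter> rank_one_layer n = {}" "low_ideal n 2 \<inter> rank_zero_layer n = {}"
  "rank_one_layer n \<inter> rank_zero_layer n = {}"
  by (auto simp: layer_defs)

section \<open>Congruences glued from ideals and layers\<close>

lemma congruence_on_glue_low_ideal:
  "congruence_on (twisted_partition_monoid n)
    (glue (UNIV \<times> partitions n) {} (low_ideal n k) split_elem)"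
proof -
  have "congruence_on (twisted_partition_monoid n)
      (glue (carrier (twisted_partition_monoid n)) {} (low_ideal n k) split_elem)"
  proof (rule twisted.congruence_on_glue[where I = "{}"])
    show "low_ideal n k \<subseteq> carrier (twisted_partition_monoid n)"
      using layer_subset(1)[of n k] by simp
    show "x \<otimes>\<^bsub>twisted_partition_monoid n\<^esub> u \<in> low_ideal n k \<union> {} \<and>
        u \<otimes>\<^bsub>twisted_partition_monoid n\<^esub> x \<in> low_ideal n k \<union> {}"
      if "x \<in> low_ideal n k" "u \<in> carrier (twisted_partition_monoid n)" for x u
      using translate_low_ideal[OF that(1), of u] that(2) by simp
    show "split_elem (x \<otimes>\<^bsub>twisted_partition_monoid n\<^esub> u) =
        split_elem (y \<otimes>\<^bsub>twisted_partition_monoid n\<^esub> u) \<and>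
      split_elem (u \<otimes>\<^bsub>twisted_partition_monoid n\<^esub> x) =
        split_elem (u \<otimes>\<^bsub>twisted_partition_monoid n\<^esub> y)"
      if "x \<in> low_ideal n k" "y \<in> low_ideal n k" "split_elem x = split_elem y"
        "u \<in> carrier (twisted_partition_monoid n)" for x y u
      using that by (intro split_elem_translate_eq) (auto simp: low_ideal_def)
  qed auto
  then show ?thesis by simp
qed

text \<open>Each layer is stable under translations up to falling into \<open>low_ideal n 2\<close>,
  and levels separate both layers from that ideal. Hence any disjoint choice of collapsed layers
  \<open>A\<close> and glued layers \<open>H\<close> works, which covers all five congruences of the
  diamond at once.\<close>

lemma congruence_on_glue_layers:
  assumes "A \<subseteq> {rank_one_layer n, rank_zero_layer n}" "H \<subseteq> {rank_one_layer n, rank_zero_layer n}"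
    and "\<Union>A \<inter> \<Union>H = {}"
  shows "congruence_on (twisted_partition_monoid n)
    (glue (UNIV \<times> partitions n) (low_ideal n 2 \<union> \<Union>A) (\<Union>H) split_elem)"
proof -
  have layer: "y \<in> K \<union> low_ideal n 2"
    if "K \<in> {rank_one_layer n, rank_zero_layer n}" "x \<in> K" "s \<in> UNIV \<times> partitions n"
      "y = x \<otimes>\<^bsub>twisted_partition_monoid n\<^esub> s \<or> y = s \<otimes>\<^bsub>twisted_partition_monoid n\<^esub> x"
    for K x s y
    using that translate_rank_one_layer[of x n s y] translate_rank_zero_layer[of x n s y]
    by blast
  have sub: "\<Union>A \<subseteq> rank_one_layer n \<union> rank_zero_layer n"
    "\<Union>H \<subseteq> rank_one_layer n \<union> rank_zero_layer n"
    using assms(1,2) by blast+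
  have "congruence_on (twisted_partition_monoid n)
      (glue (carrier (twisted_partition_monoid n)) (low_ideal n 2 \<union> \<Union>A) (\<Union>H) split_elem)"
  proof (rule twisted.congruence_on_glue[where I = "low_ideal n 2"])
    show "low_ideal n 2 \<union> \<Union>A \<subseteq> carrier (twisted_partition_monoid n)"
      "\<Union>H \<subseteq> carrier (twisted_partition_monoid n)"
      using sub layer_subset[of n] by auto
    show "(low_ideal n 2 \<union> \<Union>A) \<inter> \<Union>H = {}"
      using sub assms(3) layer_disjoint[of n] by blast
    show "low_ideal n 2 \<subseteq> low_ideal n 2 \<union> \<Union>A" by simp
    show "x \<otimes>\<^bsub>twisted_partition_monoid n\<^esub> u \<in> low_ideal n 2 \<union> \<Union>A \<and>
        u \<otimes>\<^bsub>twisted_partition_monoid n\<^esub> x \<in> low_ideal n 2 \<union> \<Union>A"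
      if x: "x \<in> low_ideal n 2 \<union> \<Union>A" and u: "u \<in> carrier (twisted_partition_monoid n)" for x u
    proof (cases "x \<in> low_ideal n 2")
      case True
      then show ?thesis using translate_low_ideal[of x n 2 u] u by simp
    next
      case False
      then obtain K where K: "K \<in> A" "x \<in> K" using x by blast
      then have K': "K \<in> {rank_one_layer n, rank_zero_layer n}" using assms(1) by blast
      have "u \<in> UNIV \<times> partitions n" using u by simp
      from layer[OF K' K(2) this] K(1) show ?thesis by blast
    qed
    show "x \<otimes>\<^bsub>twisted_partition_monoid n\<^esub> u \<in> \<Union>H \<union> low_ideal n 2 \<and>
        u \<otimes>\<^bsub>twisted_partition_monoid n\<^esub> x \<in> \<Union>H \<union> low_ideal n 2"
      if x: "x \<in> \<Union>H" and u: "u \<in> carrier (twisted_partition_monoid n)" for x u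
    proof -
      obtain K where K: "K \<in> H" "x \<in> K" using x by blast
      then have K': "K \<in> {rank_one_layer n, rank_zero_layer n}" using assms(2) by blast
      have "u \<in> UNIV \<times> partitions n" using u by simp
      from layer[OF K' K(2) this] K(1) show ?thesis by blast
    qed
    show "split_elem x \<noteq> split_elem y" if "x \<in> \<Union>H" "y \<in> low_ideal n 2" for x y
    proof -
      have "level x = 1" "2 \<le> level y"
        using that sub(2) by (auto simp: layer_defs)
      then show ?thesis by (auto simp: level_def)
    qed
    show "split_elem (x \<otimes>\<^bsub>twisted_partition_monoid n\<^esub> u) =
        split_elem (y \<otimes>\<^bsub>twisted_partition_monoid n\<^esub> u) \<and>
      split_elem (u \<otimes>\<^bsub>twisted_partition_monoid n\<^esub> x) =
        split_elem (u \<otimes>\<^bsub>twisted_partition_monoid n\<^esub> y)"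
      if "x \<in> \<Union>H" "y \<in> \<Union>H" "split_elem x = split_elem y"
        "u \<in> carrier (twisted_partition_monoid n)" for x y u
    proof -
      have "\<Union>H \<subseteq> UNIV \<times> low_rank n" using sub(2) by (auto simp: layer_defs)
      then show ?thesis using that by (intro split_elem_translate_eq) auto
    qed
  qed
  then show ?thesis by simp
qed

section \<open>The pentagon\<close>

lemma pentagon_congruences:
  assumes "n \<ge> 1"
  shows "contains_pentagon (Cong (twisted_partition_monoid n))"
    "\<not> modular (Cong (twisted_partition_monoid n))"
    "\<not> distributive (Cong (twisted_partition_monoid n))"
proof -
  let ?M = "twisted_partition_monoid n" and ?S = "UNIV \<times> partitions n :: (nat \<times> vertex set set) set"
  define a where "a = {(x, y) \<in> ?S \<times> ?S. snd x = snd y}"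
  define b where "b = glue ?S {} (low_ideal n 2) split_elem"
  define c where "c = glue ?S {} (low_ideal n 1) split_elem"
  have a: "congruence_on ?M a"
  proof (rule twisted.congruence_onI)
    show "equiv (carrier ?M) a"
      by (rule equivI) (auto simp: a_def refl_on_def sym_def trans_def)
    show "(x \<otimes>\<^bsub>?M\<^esub> u, y \<otimes>\<^bsub>?M\<^esub> u) \<in> a" "(u \<otimes>\<^bsub>?M\<^esub> x, u \<otimes>\<^bsub>?M\<^esub> y) \<in> a"
      if "(x, y) \<in> a" "u \<in> carrier ?M" for x y u
      using that by (auto simp: a_def mult_twisted partition_mult_closed)
  qed
  have b: "congruence_on ?M b" and c: "congruence_on ?M c"
    unfolding b_def c_def by (rule congruence_on_glue_low_ideal)+
  have "b \<subseteq> c" by (auto simp: b_def c_def glue_def low_ideal_def)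
  moreover have "b \<noteq> c"
  proof -
    \<comment> \<open>The one-block partition has rank one, so \<open>?x\<close> has level 1, and
      its partner \<open>?y\<close> has the same image under \<open>split_elem\<close>. The pair is
      glued from level 1 on but not from level 2 on.\<close>
    let ?x = "(1, {boundary n}) :: nat \<times> vertex set set"
    let ?y = "(0, split {boundary n}) :: nat \<times> vertex set set"
    have x: "?x \<in> rank_one_layer n"
      using boundary_low_rank[OF assms] by (simp add: rank_one_layer_def level_def split_elem_def)
    note y = rank_zero_partner[OF x, unfolded snd_conv]
    have "?x \<in> low_ideal n 1" "?y \<in> low_ideal n 1" "?x \<notin> low_ideal n 2"
      using x y by (auto simp: layer_defs)
    then have "(?x, ?y) \<in> c" "(?x, ?y) \<notin> b"
      using y by (auto simp: b_def c_def glue_def)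
    then show ?thesis by blast
  qed
  moreover have "a \<inter> c \<subseteq> b"
  proof (rule subrelI)
    fix x y assume "(x, y) \<in> a \<inter> c"
    then have xy: "x \<in> ?S" "snd x = snd y" "x = y \<or> split_elem x = split_elem y"
      by (auto simp: a_def c_def glue_def)
    \<comment> \<open>Equal second coordinates add the same summand in \<open>split_elem\<close>, so
      equal values force equal first coordinates.\<close>
    then have "x = y" by (auto simp: split_elem_def prod_eq_iff)
    then show "(x, y) \<in> b" using xy(1) by (simp add: b_def glue_def Id_on_iff)
  qed
  moreover have "c \<subseteq> a \<squnion>\<^bsub>Cong ?M\<^esub> b"
  proof (rule subrelI)
    let ?j = "a \<squnion>\<^bsub>Cong ?M\<^esub> b"
    have j: "a \<subseteq> ?j" "b \<subseteq> ?j" "congruence_on ?M ?j"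
      using twisted.Cong.join_left[of a n b] twisted.Cong.join_right[of a n b]
        twisted.Cong.join_closed[of a n b] a b by simp_all
    then have eq: "equiv ?S ?j" by (simp add: congruence_on_def)
    \<comment> \<open>Raising the first coordinate stays in a class of \<open>a\<close>, preserves
      equality under \<open>split_elem\<close> and lifts level 1 to level 2, where \<open>b\<close>
      applies. So \<open>x\<close> and \<open>y\<close> are joined through \<open>up x\<close> and
      \<open>up y\<close>.\<close>
    define up where "up x = (fst x + 1, snd x)" for x :: "nat \<times> vertex set set"
    have up: "(x, up x) \<in> a" "up x \<in> low_ideal n 2"
      "split_elem (up x) = (fst (split_elem x) + 1, snd (split_elem x))"
      if "x \<in> low_ideal n 1" for x
      using that by (auto simp: low_rank_partitions up_def a_def low_ideal_def level_def split_elem_def)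
    fix x y assume xy: "(x, y) \<in> c"
    show "(x, y) \<in> ?j"
    proof (cases "x = y")
      case True
      then show ?thesis using xy eq c by (auto simp: congruence_on_def equiv_def refl_on_def)
    next
      case False
      then have "x \<in> low_ideal n 1" "y \<in> low_ideal n 1" "split_elem x = split_elem y"
        using xy by (auto simp: c_def glue_def)
      then have "(x, up x) \<in> ?j" "(up x, up y) \<in> b" "(y, up y) \<in> ?j"
        using up[of x] up[of y] j by (auto simp: b_def glue_def)
      then show ?thesis using j(2) eq by (meson equivE subsetD symD transD)
    qed
  qed
  moreover have "a \<sqinter>\<^bsub>Cong ?M\<^esub> c = a \<inter> c"
    using a c by (rule twisted.meet_Cong)
  ultimately have "b \<sqsubset>\<^bsub>Cong ?M\<^esub> c" "a \<sqinter>\<^bsub>Cong ?M\<^esub> c \<sqsubseteq>\<^bsub>Cong ?M\<^esub> b" "c \<sqsubseteq>\<^bsub>Cong ?M\<^esub> a \<squnion>\<^bsub>Cong ?M\<^esub> b"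
    by (simp_all add: lless_def twisted.Cong.eq_is_equal)
  then show "contains_pentagon (Cong ?M)" "\<not> modular (Cong ?M)" "\<not> distributive (Cong ?M)"
    using twisted.Cong.contains_pentagon_criterion[of a n b c] a b c by simp_all
qed

section \<open>The diamond\<close>

lemma glue_subset_equiv:
  assumes "equiv S q" and "\<And>x. x \<in> A \<Longrightarrow> (x, p) \<in> q"
  shows "glue S A {} f \<subseteq> q"
proof -
  \<comment> \<open>The point \<open>p\<close> is a pivot through which any two elements of the
    collapsed class are related.\<close>
  have "(x, y) \<in> q" if "x \<in> A" "y \<in> A" for x y
    using assms(1) assms(2)[OF that(1)] assms(2)[OF that(2)] by (meson equivE symD transD)
  moreover have "Id_on S \<subseteq> q" using assms(1) by (auto simp: equiv_def refl_on_def)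
  ultimately show ?thesis by (auto simp: glue_def)
qed

lemma diamond_congruences:
  assumes "n \<ge> 1"
  shows "contains_diamond (Cong (twisted_partition_monoid n))"
proof -
  let ?M = "twisted_partition_monoid n" and ?S = "UNIV \<times> partitions n :: (nat \<times> vertex set set) set"
  let ?X = "rank_one_layer n" and ?Y = "rank_zero_layer n" and ?I = "low_ideal n 2"
  define a where "a = glue ?S (?I \<union> ?X) {} split_elem"
  define b where "b = glue ?S (?I \<union> ?Y) ?X split_elem"
  define c where "c = glue ?S ?I (?X \<union> ?Y) split_elem"
  define z where "z = glue ?S ?I ?X split_elem"
  define t where "t = glue ?S (?I \<union> ?X \<union> ?Y) {} split_elem"
  have a: "congruence_on ?M a" and b: "congruence_on ?M b" and c: "congruence_on ?M c"
    and z: "congruence_on ?M z" and t: "congruence_on ?M t"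
    using congruence_on_glue_layers[of "{?X}" n "{}"] congruence_on_glue_layers[of "{?Y}" n "{?X}"]
      congruence_on_glue_layers[of "{}" n "{?X, ?Y}"] congruence_on_glue_layers[of "{}" n "{?X}"]
      congruence_on_glue_layers[of "{?X, ?Y}" n "{}"] layer_disjoint[of n]
    by (simp_all add: a_def b_def c_def z_def t_def Un_assoc Int_commute)
  note disj = layer_disjoint[of n]
  \<comment> \<open>On \<open>?X\<close> all three relations contain the kernel of
    \<open>split_elem\<close>, so it survives in \<open>z\<close>. On \<open>?Y\<close> the first
    two meets reduce to equality because \<open>a\<close> does; for \<open>b \<inter> c\<close> this
    is the injectivity of \<open>split_elem\<close> there.\<close>
  have meets: "a \<inter> b = z" "a \<inter> c = z" "b \<inter> c = z"
    using disj split_elem_inj_rank_zero[of _ n] layer_subset[of n]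
    unfolding a_def b_def c_def z_def glue_def by blast+
  have sub: "a \<subseteq> t" "b \<subseteq> t" "c \<subseteq> t"
    unfolding a_def b_def c_def t_def glue_def by blast+
  \<comment> \<open>In rank one the level is the first coordinate, so the 2 puts this pivot into
    \<open>?I\<close>.\<close>
  define p :: "nat \<times> vertex set set" where "p = (2, {boundary n})"
  have p: "p \<in> ?I"
    using boundary_low_rank[OF assms] by (simp add: p_def low_ideal_def level_def split_elem_def)
  have aq: "(x, p) \<in> q" if "a \<subseteq> q" "x \<in> ?I \<union> ?X" for x q
    using that p by (auto simp: a_def glue_def)
  have bq: "(x, p) \<in> q" if "b \<subseteq> q" "x \<in> ?I \<union> ?Y" for x q
    using that p by (auto simp: b_def glue_def)
  have cq: "(x, y) \<in> q" if "c \<subseteq> q" "x \<in> ?X \<union> ?Y" "y \<in> ?X \<union> ?Y" "split_elem x = split_elem y" for x y q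
    using that by (auto simp: c_def glue_def)
  have "a \<squnion>\<^bsub>Cong ?M\<^esub> b = t"
  proof (rule twisted.join_Cong_eqI[OF a b t sub(1,2)])
    fix q assume q: "equiv (carrier ?M) q" "a \<subseteq> q" "b \<subseteq> q"
    show "t \<subseteq> q"
      unfolding t_def
      by (rule glue_subset_equiv[where p = p]) (use q aq bq in auto)
  qed
  moreover have "a \<squnion>\<^bsub>Cong ?M\<^esub> c = t"
  proof (rule twisted.join_Cong_eqI[OF a c t sub(1,3)])
    fix q assume q: "equiv (carrier ?M) q" "a \<subseteq> q" "c \<subseteq> q"
    \<comment> \<open>An element of \<open>?Y\<close> is moved into \<open>?X\<close> by
      \<open>c\<close> and from there to \<open>p\<close> by \<open>a\<close>. In the join of
      \<open>b\<close> and \<open>c\<close> the two layers exchange their roles.\<close>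
    have "(y, p) \<in> q" if "y \<in> ?Y" for y
    proof -
      obtain x where "x \<in> ?X" "split_elem x = split_elem y"
        using rank_one_partner[OF assms \<open>y \<in> ?Y\<close>] .
      then have "(y, x) \<in> q" "(x, p) \<in> q" using that cq[OF q(3), of y x] aq[OF q(2), of x] by auto
      then show ?thesis using q(1) by (meson equivE transD)
    qed
    then show "t \<subseteq> q"
      unfolding t_def
      by (intro glue_subset_equiv[where p = p]) (use q aq in auto)
  qed
  moreover have "b \<squnion>\<^bsub>Cong ?M\<^esub> c = t"
  proof (rule twisted.join_Cong_eqI[OF b c t sub(2,3)])
    fix q assume q: "equiv (carrier ?M) q" "b \<subseteq> q" "c \<subseteq> q"
    have "(x, p) \<in> q" if "x \<in> ?X" for x
    proof -
      note y = rank_zero_partner[OF that]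
      then have "(x, (0, split (snd x))) \<in> q" "((0, split (snd x)), p) \<in> q"
        using that cq[OF q(3), of x] bq[OF q(2)] by auto
      then show ?thesis using q(1) by (meson equivE transD)
    qed
    then show "t \<subseteq> q"
      unfolding t_def
      by (intro glue_subset_equiv[where p = p]) (use q bq in auto)
  qed
  moreover have "z \<noteq> t"
  proof -
    \<comment> \<open>In \<open>t\<close> the layer \<open>?X\<close> shares a class with the ideal
      containing \<open>p\<close>, whereas \<open>z\<close> keeps them apart.\<close>
    have x: "(1, {boundary n}) \<in> ?X"
      using boundary_low_rank[OF assms] by (simp add: rank_one_layer_def level_def split_elem_def)
    then have "((1, {boundary n}), p) \<in> t" "((1, {boundary n}), p) \<notin> z"
      using p disj by (auto simp: t_def z_def glue_def)
    then show ?thesis by blast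
  qed
  ultimately show ?thesis
    using twisted.Cong.contains_diamond_criterion[of a n b c z t] a b c
      twisted.meet_Cong[OF a b] twisted.meet_Cong[OF a c] twisted.meet_Cong[OF b c] meets
    by simp
qed

theorem theorem4p6:
  fixes n :: nat
  assumes "n \<ge> 1"
  shows "contains_diamond (Cong (twisted_partition_monoid n)) \<and>
    contains_pentagon (Cong (twisted_partition_monoid n)) \<and>
    \<not> modular (Cong (twisted_partition_monoid n)) \<and>
    \<not> distributive (Cong (twisted_partition_monoid n))"
  using diamond_congruences[OF assms] pentagon_congruences[OF assms] by blast

end
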